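(* Let $D=\{(0,0)^t,(\alpha_1,\alpha_2)^t,(\beta_1,\beta_2)^t\}\subset\mathbb{Z}^2$ with $\alpha_1\beta_2-\alpha_2\beta_1\neq 0$ and $\gcd(\alpha_1,\alpha_2,\beta_1,\beta_2)=1$. (i) Suppose $2\alpha_1-\beta_1\notin 3\mathbb{Z}$ or $2\alpha_2-\beta_2\notin 3\mathbb{Z}$. Then for every expanding matrix $M\in M_2(\mathbb{Z})$ with $\det(M)\notin 3\mathbb{Z}$ there exist at most $9$ mutually orthogonal exponential functions in $L^2(\mu_{M,D})$, and the number $9$ is the best: there exists an expanding matrix $M\in M_2(\mathbb{Z})$ with $\det(M)\notin 3\mathbb{Z}$ for which $L^2(\mu_{M,D})$ contains $9$ mutually orthogonal exponential functions. (ii) Suppose $2\alpha_1-\beta_1\in 3\mathbb{Z}$ and $2\alpha_2-\beta_2\in 3\mathbb{Z}$, and let $\eta=\max\{r: 3^r\mid(\alpha_1\beta_2-\alpha_2\beta_1)\}$. Then for every expanding matrix $M\in M_2(\mathbb{Z})$ with $\det(M)\notin 3\mathbb{Z}$ there exist at most $3^{2\eta}$ mutually orthogonal exponential functions in $L^2(\mu_{M,D})$, and the number $3^{2\eta}$ is the best: there exists an expanding matrix $M\in M_2(\mathbb{Z})$ with $\det(M)\notin 3\mathbb{Z}$ for which $L^2(\mu_{M,D})$ contains $3^{2\eta}$ mutually orthogonal exponential functions.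
   Context: A square real matrix $M$ is expanding if all its eigenvalues have modulus $>1$. For an expanding matrix $M\in M_n(\mathbb{R})$ and a finite digit set $D\subset\mathbb{R}^n$ put $\phi_d(x)=M^{-1}(x+d)$ for $x\in\mathbb{R}^n$, $d\in D$. The self-affine measure $\mu_{M,D}$ is the unique Borel probability measure $\mu$ on $\mathbb{R}^n$ with $\mu=\frac{1}{|D|}\sum_{d\in D}\mu\circ\phi_d^{-1}$. Exponential functions are the functions $x\mapsto e^{2\pi i\langle\lambda,x\rangle}$ with $\lambda\in\mathbb{R}^n$. "There exist at most $k$ mutually orthogonal exponential functions in $L^2(\mu)$" means: if $\Lambda\subset\mathbb{R}^n$ is such that $e^{2\pi i\langle\lambda,x\rangle}$ and $e^{2\pi i\langle\lambda',x\rangle}$ are orthogonal in $L^2(\mu)$ for all distinct $\lambda,\lambda'\in\Lambda$, then $|\Lambda|\le k$. "$L^2(\mu)$ contains $k$ mutually orthogonal exponential functions" means that such a $\Lambda$ with $|\Lambda|=k$ exists. *)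

theory Defs
  imports "HOL-Probability.Probability"
begin

definition complex_eigenvalue :: "real^'n^'n \<Rightarrow> complex \<Rightarrow> bool" where
  "complex_eigenvalue M z \<longleftrightarrow>
     (\<exists>v::complex^'n. v \<noteq> 0 \<and> map_matrix complex_of_real M *v v = z *s v)"

definition expanding :: "real^'n^'n \<Rightarrow> bool" where
  "expanding M \<longleftrightarrow> (\<forall>z. complex_eigenvalue M z \<longrightarrow> norm z > 1)"

abbreviation real_mat :: "int^'n^'m \<Rightarrow> real^'n^'m" where
  "real_mat \<equiv> map_matrix real_of_int"

definition \<phi> :: "real^'n^'n \<Rightarrow> real^'n \<Rightarrow> real^'n \<Rightarrow> real^'n" where
  "\<phi> M d x = matrix_inv M *v (x + d)"

definition is_self_affine_measure ::
    "real^'n^'n \<Rightarrow> (real^'n) set \<Rightarrow> (real^'n) measure \<Rightarrow> bool" where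
  "is_self_affine_measure M D \<mu> \<longleftrightarrow>
     prob_space \<mu> \<and> sets \<mu> = sets borel \<and>
     (\<forall>A\<in>sets borel. measure \<mu> A = (1 / real (card D)) * (\<Sum>d\<in>D. measure \<mu> (\<phi> M d -` A)))"

(* For expanding M and finite nonempty D, existence and uniqueness are Hutchinson's theorem;
   for other arguments the value is unspecified. *)
definition self_affine_measure ::
    "real^'n^'n \<Rightarrow> (real^'n) set \<Rightarrow> (real^'n) measure" where
  "self_affine_measure M D = (THE \<mu>. is_self_affine_measure M D \<mu>)"

definition exponential :: "real^'n \<Rightarrow> real^'n \<Rightarrow> complex" where
  "exponential \<xi> x = exp (2 * complex_of_real pi * \<i> * complex_of_real (\<xi> \<bullet> x))"

definition orthogonal_in_L2 ::
    "(real^'n) measure \<Rightarrow> (real^'n \<Rightarrow> complex) \<Rightarrow> (real^'n \<Rightarrow> complex) \<Rightarrow> bool" where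
  "orthogonal_in_L2 \<mu> f g \<longleftrightarrow> (LINT x|\<mu>. f x * cnj (g x)) = 0"

(* Index sets of families of mutually orthogonal exponentials. *)
definition orthogonal_exponentials :: "(real^'n) measure \<Rightarrow> (real^'n) set \<Rightarrow> bool" where
  "orthogonal_exponentials \<mu> \<Lambda> \<longleftrightarrow>
     (\<forall>\<xi>\<in>\<Lambda>. \<forall>\<kappa>\<in>\<Lambda>. \<xi> \<noteq> \<kappa> \<longrightarrow> orthogonal_in_L2 \<mu> (exponential \<xi>) (exponential \<kappa>))"

definition at_most_orthogonal_exponentials :: "(real^'n) measure \<Rightarrow> nat \<Rightarrow> bool" where
  "at_most_orthogonal_exponentials \<mu> k \<longleftrightarrow>
     (\<forall>\<Lambda>. orthogonal_exponentials \<mu> \<Lambda> \<longrightarrow> finite \<Lambda> \<and> card \<Lambda> \<le> k)"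

definition contains_orthogonal_exponentials :: "(real^'n) measure \<Rightarrow> nat \<Rightarrow> bool" where
  "contains_orthogonal_exponentials \<mu> k \<longleftrightarrow>
     (\<exists>\<Lambda>. orthogonal_exponentials \<mu> \<Lambda> \<and> finite \<Lambda> \<and> card \<Lambda> = k)"

end

theory Submission
  imports Defs
begin

text \<open>
  The Fourier transform of \<open>\<mu> = \<mu>\<^bsub>M,D\<^esub>\<close> satisfies
  \<open>\<mu>^(\<xi>) = m(M\<^sup>-\<^sup>t \<xi>) \<mu>^(M\<^sup>-\<^sup>t \<xi>)\<close>, where \<open>m\<close> is the mask of \<open>D\<close>, and \<open>M\<^sup>-\<^sup>t\<close> contracts, so the
  zeros of \<open>\<mu>^\<close> are exactly the forward orbits under \<open>M\<^sup>t\<close> of the zeros of \<open>m\<close>. A zero of \<open>m\<close> is a point whose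
  inner products with the two nonzero digits are \<open>1/3, 2/3\<close> modulo 1, in some order. Let
  \<open>\<Delta> = \<alpha>\<^sub>1 \<beta>\<^sub>2 - \<alpha>\<^sub>2 \<beta>\<^sub>1\<close>. By Cramer's rule, \<open>3\<Delta>\<close> times a zero is an integer vector, in case (i)
  not divisible by 3; in case (ii) already \<open>\<Delta>\<close> times a zero is integral, and not divisible by
  \<open>3\<^sup>\<eta>\<close>. Since \<open>det M\<close> is prime to 3, \<open>M\<^sup>t\<close> preserves this, so the rescaled frequencies of an orthogonal
  family are pairwise incongruent modulo 3 (modulo \<open>3\<^sup>\<eta>\<close>), which bounds their number.

  The bound is attained by one matrix, twice the Fibonacci matrix \<open>P\<close>. Modulo \<open>3\<^sup>n\<close> and up to
  scalars prime to 3, the powers of \<open>P\<close> act transitively on vectors not divisible by 3, because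
  \<open>P\<close> has no eigenvector modulo 3 and \<open>P\<^sup>k\<close> with \<open>k = 4 \<sqdot> 3\<^sup>n\<^sup>-\<^sup>1\<close> is a scalar plus \<open>3\<^sup>n\<close> times a unit multiple
  of \<open>P\<close>, modulo \<open>3\<^sup>n\<^sup>+\<^sup>1\<close>. So every \<open>2\<^sup>J y / 3\<^sup>n\<close> with \<open>J\<close> large lies in the orbit of the zeros of the mask; the factor
  \<open>2\<^sup>J\<close> absorbs the powers of 2 from iterating \<open>2P\<close>.
\<close>

subsection \<open>Contraction by the inverse of an expanding matrix\<close>

text \<open>Stands in for contraction. \<open>B\<close> may enlarge some vectors in the Euclidean
  norm, so no one-step bound is asked for; summability gives both convergent digit series and orbits
  tending to 0.\<close>

definition summable_orbits :: "real^'n^'n \<Rightarrow> bool" where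
  "summable_orbits B \<longleftrightarrow> (\<forall>v. summable (\<lambda>j. norm (((*v) B ^^ j) v)))"

text \<open>Splitting off the root \<open>l\<close> leaves the geometric sequence \<open>u\<close>
  with ratio \<open>l'\<close>; summing the resulting first-order inequality bounds the partial
  sums. This also covers a double root.\<close>

lemma linear_recurrence_summable:
  fixes a :: "nat \<Rightarrow> complex"
  assumes rec: "\<And>n. a (Suc (Suc n)) = (l + l') * a (Suc n) - l * l' * a n"
    and l: "norm l < 1" and l': "norm l' < 1"
  shows "summable (\<lambda>n. norm (a n))"
proof (rule summableI_nonneg_bounded)
  define u where "u n = a (Suc n) - l * a n" for n
  have u: "u n = l' ^ n * u 0" for n
  proof (induction n)
    case (Suc n)
    have "u (Suc n) = l' * u n" by (simp add: u_def rec algebra_simps)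
    then show ?case using Suc by simp
  qed simp
  define K where "K = norm (a 0) + norm (u 0) / (1 - norm l')"
  have "norm (a (Suc n)) \<le> norm l * norm (a n) + norm l' ^ n * norm (u 0)" for n
  proof -
    have "a (Suc n) = l * a n + l' ^ n * u 0"
      using u[of n] by (simp add: u_def algebra_simps)
    then show ?thesis by (metis norm_mult norm_power norm_triangle_ineq)
  qed
  then have step: "(\<Sum>n<N. norm (a (Suc n))) \<le> norm l * (\<Sum>n<N. norm (a n)) + (\<Sum>n<N. norm l' ^ n) * norm (u 0)" for N
    using sum_mono[of "{..<N}" "\<lambda>n. norm (a (Suc n))"]
    by (simp add: sum_distrib_left sum_distrib_right flip: sum.distrib)
  have geo: "(\<Sum>n<N. norm l' ^ n) * norm (u 0) \<le> norm (u 0) / (1 - norm l')" for N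
  proof -
    have "(\<Sum>n<N. norm l' ^ n) = (1 - norm l' ^ N) / (1 - norm l')"
      using l' by (simp add: sum_gp_strict)
    also have "\<dots> \<le> 1 / (1 - norm l')" using l' by (intro divide_right_mono) auto
    finally show ?thesis using mult_right_mono[of _ _ "norm (u 0)"] by fastforce
  qed
  have "(\<Sum>n<N. norm (a n)) \<le> K / (1 - norm l)" for N
  proof -
    have "(\<Sum>n<N. norm (a n)) \<le> (\<Sum>n<Suc N. norm (a n))" by simp
    moreover have "(\<Sum>n<Suc N. norm (a n)) = norm (a 0) + (\<Sum>n<N. norm (a (Suc n)))"
      by (rule sum.lessThan_Suc_shift)
    ultimately have "(\<Sum>n<N. norm (a n)) \<le> K + norm l * (\<Sum>n<N. norm (a n))"
      using step[of N] geo[of N] unfolding K_def by linarith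
    then show ?thesis using l by (simp add: le_divide_eq algebra_simps)
  qed
  then show "(\<Sum>n<N. norm (a n)) \<le> K / (1 - norm l)" for N .
qed simp

text \<open>By Cayley-Hamilton each coordinate of an orbit satisfies the recurrence whose
  characteristic roots are the eigenvalues of \<open>B\<close>; these may be non-real, hence the
  passage to complex sequences.\<close>

lemma summable_orbits_2:
  fixes B :: "real^2^2"
  assumes roots: "\<And>z::complex. z\<^sup>2 - of_real (B$1$1 + B$2$2) * z + of_real (det B) = 0 \<Longrightarrow> norm z < 1"
  shows "summable_orbits B"
proof -
  define t d where "t = B$1$1 + B$2$2" and "d = det B"
  define s where "s = csqrt (of_real (t\<^sup>2 - 4 * d))"
  define l l' where "l = (of_real t + s) / 2" and "l' = (of_real t - s) / 2"
  have s2: "s\<^sup>2 = of_real (t\<^sup>2 - 4 * d)" by (simp add: s_def)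
  have sum: "l + l' = of_real t" by (simp add: l_def l'_def field_simps)
  have prod: "l * l' = of_real d"
    using s2 by (simp add: l_def l'_def field_simps power2_eq_square)
  have "(z - l) * (z - l') = z\<^sup>2 - of_real t * z + of_real d" for z
    using sum prod by (simp add: power2_eq_square algebra_simps flip: sum prod)
  then have "norm l < 1" "norm l' < 1"
    using roots[folded t_def d_def] by (metis diff_self mult_zero_left mult_zero_right)+
  note summable = linear_recurrence_summable[of _ l l', OF _ this]
  have CH: "B *v (B *v v) = t *\<^sub>R (B *v v) - d *\<^sub>R v" for v
    by (simp add: vec_eq_iff forall_2 matrix_vector_mult_def sum_2 t_def d_def det_2 algebra_simps)
  have "summable (\<lambda>j. norm (((*v) B ^^ j) v))" for v
  proof -
    have "summable (\<lambda>j. norm (complex_of_real ((((*v) B ^^ j) v) $ i)))" for i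
      by (rule summable) (simp add: CH sum prod)
    then have "summable (\<lambda>j. \<Sum>i\<in>UNIV. \<bar>(((*v) B ^^ j) v) $ i\<bar>)"
      by (intro summable_sum) simp
    then show ?thesis
      by (rule summable_comparison_test[rotated]) (use norm_le_l1_cart in auto)
  qed
  then show ?thesis by (simp add: summable_orbits_def)
qed

lemma matrix_inv_mul:
  fixes A :: "'a::field^'n^'n"
  assumes "det A \<noteq> 0"
  shows "A ** matrix_inv A = mat 1" "matrix_inv A ** A = mat 1"
proof -
  have "\<exists>A'. A ** A' = mat 1 \<and> A' ** A = mat 1"
    using assms by (simp add: invertible_det_nz flip: invertible_def)
  then have "A ** matrix_inv A = mat 1 \<and> matrix_inv A ** A = mat 1"
    unfolding matrix_inv_def by (rule someI_ex)
  then show "A ** matrix_inv A = mat 1" "matrix_inv A ** A = mat 1" by auto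
qed

lemma complex_eigenvalue_2:
  fixes M :: "real^2^2"
  assumes z: "z\<^sup>2 - of_real (M$1$1 + M$2$2) * z + of_real (det M) = 0"
  shows "complex_eigenvalue M z"
proof -
  define A :: "complex^2^2" where "A = map_matrix complex_of_real M - mat z"
  have "det A = 0"
    using z by (simp add: A_def det_2 map_matrix_def mat_def algebra_simps power2_eq_square)
  then have "\<not> (\<exists>B. B ** A = mat 1)"
    by (metis invertible_det_nz invertible_left_inverse)
  then obtain v where v: "v \<noteq> 0" "A *v v = 0"
    by (auto simp: matrix_left_invertible_ker)
  have "mat z *v v = z *s v"
    by (simp add: vec_eq_iff forall_2 matrix_vector_mult_def sum_2 mat_def)
  then show ?thesis
    using v by (auto simp: complex_eigenvalue_def A_def matrix_vector_mult_diff_rdistrib)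
qed

text \<open>Up to the factor \<open>det M\<close>, the characteristic polynomial of the inverse is
  that of \<open>M\<close> with its coefficients reversed, so its roots are reciprocals of
  eigenvalues of \<open>M\<close>.\<close>

lemma expanding_summable_orbits_inv:
  fixes M :: "real^2^2"
  assumes M: "expanding M" and det: "det M \<noteq> 0"
  shows "summable_orbits (matrix_inv M)"
proof (rule summable_orbits_2)
  let ?B = "matrix_inv M"
  have MB: "M ** ?B = mat 1" using det by (rule matrix_inv_mul)
  have detB: "det M * det ?B = 1"
    using arg_cong[OF MB, of det] by (simp add: det_mul)
  have "M$1$1 * ?B$1$1 + M$1$2 * ?B$2$1 = 1" "M$1$1 * ?B$1$2 + M$1$2 * ?B$2$2 = 0"
    "M$2$1 * ?B$1$1 + M$2$2 * ?B$2$1 = 0" "M$2$1 * ?B$1$2 + M$2$2 * ?B$2$2 = 1"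
    using MB by (auto simp: vec_eq_iff forall_2 matrix_matrix_mult_def sum_2 mat_def)
  then have trB: "det M * (?B$1$1 + ?B$2$2) = M$1$1 + M$2$2"
    unfolding det_2 by algebra
  fix z :: complex
  assume z: "z\<^sup>2 - of_real (?B$1$1 + ?B$2$2) * z + of_real (det ?B) = 0"
  have eq: "of_real (det M) * z\<^sup>2 - of_real (M$1$1 + M$2$2) * z + 1 = 0"
  proof -
    have "of_real (det M) * z\<^sup>2 - of_real (det M * (?B$1$1 + ?B$2$2)) * z + of_real (det M * det ?B)
      = of_real (det M) * (z\<^sup>2 - of_real (?B$1$1 + ?B$2$2) * z + of_real (det ?B))"
      by (simp add: algebra_simps)
    then show ?thesis using z by (simp add: trB detB)
  qed
  then have [simp]: "z \<noteq> 0" by auto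
  have "(1 / z)\<^sup>2 - of_real (M$1$1 + M$2$2) * (1 / z) + of_real (det M) = 
      (of_real (det M) * z\<^sup>2 - of_real (M$1$1 + M$2$2) * z + 1) / z\<^sup>2"
    by (simp add: field_simps power2_eq_square)
  then have "complex_eigenvalue M (1 / z)"
    using eq by (intro complex_eigenvalue_2) simp
  then have "norm (1 / z) > 1" using M by (simp add: expanding_def)
  then show "norm z < 1" by (simp add: norm_divide less_divide_eq)
qed

section \<open>The extremal matrix\<close>

lemma det_real_mat_2: "det (real_mat M) = of_int (det (M :: int^2^2))"
  by (simp add: det_2 map_matrix_def)

text \<open>The Fibonacci matrix has an eigenvalue inside the unit disc; doubling gives eigenvalues
  1 + sqrt 5 and 1 - sqrt 5, both outside, and determinant -4, prime to 3.\<close>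

definition fib_matrix :: "int^2^2" where
  "fib_matrix = vector [vector [2, 2], vector [2, 0]]"

lemma expanding_fib_matrix: "expanding (real_mat fib_matrix)"
  unfolding expanding_def complex_eigenvalue_def
proof (intro allI impI, elim exE conjE)
  fix z :: complex and v :: "complex^2"
  assume "v \<noteq> 0" and ev: "map_matrix complex_of_real (real_mat fib_matrix) *v v = z *s v"
  from ev have v: "2 * v$1 + 2 * v$2 = z * v$1" "2 * v$1 = z * v$2"
    by (auto simp: vec_eq_iff forall_2 matrix_vector_mult_def sum_2 map_matrix_def fib_matrix_def)
  then have "v$2 \<noteq> 0" using \<open>v \<noteq> 0\<close> by (auto simp: vec_eq_iff forall_2)
  moreover have "((z - 1)\<^sup>2 - 5) * v$2 = 0" using v by algebra
  ultimately have "(z - 1)\<^sup>2 = (of_real (sqrt 5))\<^sup>2"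
    by (simp flip: of_real_power)
  then have "z - 1 = of_real (sqrt 5) \<or> z - 1 = - of_real (sqrt 5)" by (simp add: power2_eq_iff)
  then have "z = of_real (1 + sqrt 5) \<or> z = of_real (1 - sqrt 5)" by (auto simp: algebra_simps)
  moreover have "sqrt 5 > 2" by (rule real_less_rsqrt) simp
  ultimately show "1 < norm z" by (auto simp del: of_real_add of_real_diff)
qed

subsection \<open>Existence and uniqueness of the self-affine measure\<close>

lemma \<phi>_borel_measurable [measurable]:
  assumes [measurable]: "f \<in> borel_measurable N" "g \<in> borel_measurable N"
  shows "(\<lambda>x. \<phi> M (f x) (g x)) \<in> borel_measurable N"
proof -
  have [measurable]: "(\<lambda>x. matrix_inv M *v x) \<in> borel_measurable borel"
    by (intro borel_measurable_continuous_onI matrix_vector_mult_linear_continuous_on)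
  show ?thesis
    unfolding \<phi>_def by measurable
qed

lemma measurable_pmf_pair:
  fixes \<mu> :: "'a::topological_space measure"
  assumes sets: "sets \<mu> = sets borel"
  shows "fst \<in> borel_measurable (measure_pmf p \<Otimes>\<^sub>M \<mu>)" "snd \<in> borel_measurable (measure_pmf p \<Otimes>\<^sub>M \<mu>)"
proof -
  have "id \<in> measure_pmf p \<rightarrow>\<^sub>M borel" by simp
  from measurable_compose[OF measurable_fst this]
  show "fst \<in> borel_measurable (measure_pmf p \<Otimes>\<^sub>M \<mu>)" by simp
  show "snd \<in> borel_measurable (measure_pmf p \<Otimes>\<^sub>M \<mu>)"
    using measurable_snd[of "measure_pmf p" \<mu>]
      measurable_cong_sets[OF refl sets, of "measure_pmf p \<Otimes>\<^sub>M \<mu>"] by blast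
qed

lemma self_affine_integral_pair:
  fixes f :: "real^'n \<Rightarrow> 'b::{banach,second_countable_topology}"
  assumes "prob_space \<mu>" and sets: "sets \<mu> = sets borel" and D: "finite D" "D \<noteq> {}"
    and f [measurable]: "f \<in> borel_measurable borel" and bound: "\<And>x. norm (f x) \<le> C"
  shows "(LINT x|distr (measure_pmf (pmf_of_set D) \<Otimes>\<^sub>M \<mu>) borel (\<lambda>z. \<phi> M (fst z) (snd z)). f x)
           = (1 / card D) *\<^sub>R (\<Sum>d\<in>D. LINT x|\<mu>. f (\<phi> M d x))"
proof -
  interpret \<mu>: prob_space \<mu> by fact
  let ?p = "measure_pmf (pmf_of_set D)"
  interpret P: pair_prob_space ?p \<mu> ..
  note sets [measurable_cong]
  note measurable_pmf_pair [OF sets, measurable]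
  have "integrable (?p \<Otimes>\<^sub>M \<mu>) (\<lambda>z. f (\<phi> M (fst z) (snd z)))"
    by (rule P.P.integrable_const_bound[where B = C]) (use bound in auto)
  then have "(LINT z|(?p \<Otimes>\<^sub>M \<mu>). f (\<phi> M (fst z) (snd z))) = (LINT d|?p. LINT x|\<mu>. f (\<phi> M d x))"
    using P.integral_fst[of "\<lambda>d x. f (\<phi> M d x)"] by (simp add: split_beta')
  also have "\<dots> = (1 / card D) *\<^sub>R (\<Sum>d\<in>D. LINT x|\<mu>. f (\<phi> M d x))"
    by (subst integral_measure_pmf[of D]) (use D in \<open>auto simp: scaleR_sum_right\<close>)
  finally show ?thesis
    by (simp add: integral_distr)
qed

text \<open>Invariance as a single pushforward: draw a digit uniformly, then apply
  \<open>\<phi>\<close>. In this form integrals of bounded functions are handled by substitution and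
  Fubini.\<close>

lemma is_self_affine_measure_distr:
  assumes \<mu>: "is_self_affine_measure M D \<mu>" and D: "finite D" "D \<noteq> {}"
  shows "\<mu> = distr (measure_pmf (pmf_of_set D) \<Otimes>\<^sub>M \<mu>) borel (\<lambda>z. \<phi> M (fst z) (snd z))"
    (is "_ = ?N")
proof (rule measure_eqI)
  have sets: "sets \<mu> = sets borel" and "prob_space \<mu>"
    using \<mu> by (auto simp: is_self_affine_measure_def)
  then show "sets \<mu> = sets ?N" by simp
  interpret \<mu>: prob_space \<mu> by fact
  let ?p = "measure_pmf (pmf_of_set D)"
  interpret P: pair_prob_space ?p \<mu> ..
  note sets [measurable_cong]
  note measurable_pmf_pair [OF sets, measurable]
  interpret N: prob_space ?N
    by (rule P.P.prob_space_distr) measurable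
  fix A assume "A \<in> sets \<mu>"
  then have A [measurable]: "A \<in> sets borel" by (simp add: sets)
  have [measurable]: "\<phi> M d -` A \<in> sets borel" for d
    using measurable_sets_borel[of "\<phi> M d" borel A] by measurable
  have "measure ?N A = (LINT x|?N. indicator A x)"
    by simp
  also have "\<dots> = (1 / card D) *\<^sub>R (\<Sum>d\<in>D. LINT x|\<mu>. indicator A (\<phi> M d x))"
    by (rule self_affine_integral_pair[where C = 1])
       (use \<open>prob_space \<mu>\<close> sets D in \<open>auto split: split_indicator\<close>)
  also have "(\<lambda>d. LINT x|\<mu>. indicator A (\<phi> M d x)) = (\<lambda>d. LINT x|\<mu>. indicator (\<phi> M d -` A) x :: real)"
    by (simp add: indicator_def vimage_def)
  also have "(1 / card D) *\<^sub>R (\<Sum>d\<in>D. LINT x|\<mu>. indicator (\<phi> M d -` A) x :: real) = measure \<mu> A"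
    using \<mu> A by (simp add: is_self_affine_measure_def sets_eq_imp_space_eq[OF sets] space_borel)
  finally show "emeasure \<mu> A = emeasure ?N A"
    by (simp add: \<mu>.emeasure_eq_measure N.emeasure_eq_measure)
qed

lemma self_affine_integral:
  fixes f :: "real^'n \<Rightarrow> 'b::{banach,second_countable_topology}"
  assumes \<mu>: "is_self_affine_measure M D \<mu>" and D: "finite D" "D \<noteq> {}"
    and f: "f \<in> borel_measurable borel" "\<And>x. norm (f x) \<le> C"
  shows "(LINT x|\<mu>. f x) = (1 / card D) *\<^sub>R (\<Sum>d\<in>D. LINT x|\<mu>. f (\<phi> M d x))"
  using self_affine_integral_pair[of \<mu> D f C M] is_self_affine_measure_distr[OF \<mu> D] \<mu> D f
  by (simp add: is_self_affine_measure_def)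

section \<open>Uniqueness through the transfer operator\<close>

definition transfer_op :: "real^'n^'n \<Rightarrow> (real^'n) set \<Rightarrow> (real^'n \<Rightarrow> real) \<Rightarrow> real^'n \<Rightarrow> real" where
  "transfer_op M D f x = (1 / card D) * (\<Sum>d\<in>D. f (\<phi> M d x))"

text \<open>The modulus \<open>h\<close> stays abstract because \<open>matrix_inv M\<close> need not
  shrink the norm in one step; the iteration inserts the norm after \<open>n\<close> steps of the
  orbit.\<close>

lemma transfer_diff_bound:
  assumes D: "finite D" "D \<noteq> {}" and f: "\<And>x y. \<bar>f x - f y\<bar> \<le> h (x - y)"
  shows "\<bar>transfer_op M D f x - transfer_op M D f y\<bar> \<le> h (matrix_inv M *v (x - y))"
proof -
  have "\<bar>f (\<phi> M d x) - f (\<phi> M d y)\<bar> \<le> h (matrix_inv M *v (x - y))" for d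
    using f[of "\<phi> M d x" "\<phi> M d y"] by (simp add: \<phi>_def algebra_simps)
  then have "(\<Sum>d\<in>D. \<bar>f (\<phi> M d x) - f (\<phi> M d y)\<bar>) \<le> card D * h (matrix_inv M *v (x - y))"
    by (intro sum_bounded_above)
  then have "\<bar>\<Sum>d\<in>D. f (\<phi> M d x) - f (\<phi> M d y)\<bar> \<le> card D * h (matrix_inv M *v (x - y))"
    using sum_abs[of "\<lambda>d. f (\<phi> M d x) - f (\<phi> M d y)" D] by linarith
  moreover have "card D > 0" using D by (simp add: card_gt_0_iff)
  ultimately show ?thesis
    by (simp add: transfer_op_def diff_divide_distrib[symmetric] sum_subtractf[symmetric]
        abs_divide divide_le_eq mult.commute)
qed

lemma transfer_bound:
  assumes D: "finite D" "D \<noteq> {}" and f: "\<And>x. \<bar>f x\<bar> \<le> C"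
  shows "\<bar>transfer_op M D f x\<bar> \<le> C"
proof -
  have "(\<Sum>d\<in>D. \<bar>f (\<phi> M d x)\<bar>) \<le> card D * C"
    using f by (intro sum_bounded_above)
  then have "\<bar>\<Sum>d\<in>D. f (\<phi> M d x)\<bar> \<le> card D * C"
    using sum_abs[of "\<lambda>d. f (\<phi> M d x)" D] by linarith
  moreover have "card D > 0" using D by (simp add: card_gt_0_iff)
  ultimately show ?thesis
    by (simp add: transfer_op_def abs_divide divide_le_eq mult.commute)
qed

lemma transfer_pow_properties:
  assumes D: "finite D" "D \<noteq> {}"
    and f: "f \<in> borel_measurable borel" "\<And>x. \<bar>f x\<bar> \<le> C" "\<And>x y. \<bar>f x - f y\<bar> \<le> L * norm (x - y)"
  shows "(transfer_op M D ^^ n) f \<in> borel_measurable borel \<and> (\<forall>x. \<bar>(transfer_op M D ^^ n) f x\<bar> \<le> C) \<and>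
    (\<forall>x y. \<bar>(transfer_op M D ^^ n) f x - (transfer_op M D ^^ n) f y\<bar>
       \<le> L * norm (((*v) (matrix_inv M) ^^ n) (x - y)))"
proof (induction n)
  case 0
  then show ?case using f by simp
next
  case (Suc n)
  let ?g = "(transfer_op M D ^^ n) f"
  have [measurable]: "?g \<in> borel_measurable borel" using Suc by blast
  have "(\<lambda>x. (1 / card D) * (\<Sum>d\<in>D. ?g (\<phi> M d x))) \<in> borel_measurable borel"
    by measurable
  then have "(transfer_op M D ^^ Suc n) f \<in> borel_measurable borel"
    by (simp only: transfer_op_def[abs_def] funpow.simps comp_apply)
  moreover have "\<bar>(transfer_op M D ^^ Suc n) f x\<bar> \<le> C" for x
    using transfer_bound[OF D] Suc by simp
  moreover have "\<bar>(transfer_op M D ^^ Suc n) f x - (transfer_op M D ^^ Suc n) f y\<bar>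
       \<le> L * norm (((*v) (matrix_inv M) ^^ Suc n) (x - y))" for x y
    using transfer_diff_bound[OF D, of ?g "\<lambda>v. L * norm (((*v) (matrix_inv M) ^^ n) v)" M x y] Suc
    by (simp add: funpow_swap1)
  ultimately show ?case by blast
qed

text \<open>Duality: \<open>transfer_op\<close> is adjoint to the averaging map on measures, of
  which \<open>\<mu>\<close> is a fixed point.\<close>

lemma self_affine_integral_transfer:
  assumes \<mu>: "is_self_affine_measure M D \<mu>" and D: "finite D" "D \<noteq> {}"
    and f: "f \<in> borel_measurable borel" "\<And>x. \<bar>f x\<bar> \<le> C"
  shows "(LINT x|\<mu>. transfer_op M D f x) = (LINT x|\<mu>. f x)"
proof -
  interpret \<mu>: prob_space \<mu> using \<mu> by (simp add: is_self_affine_measure_def)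
  have [measurable_cong]: "sets \<mu> = sets borel" using \<mu> by (simp add: is_self_affine_measure_def)
  note f(1) [measurable]
  have "integrable \<mu> (\<lambda>x. f (\<phi> M d x))" for d
    by (rule \<mu>.integrable_const_bound[where B = C]) (use f in auto)
  then have "(LINT x|\<mu>. transfer_op M D f x) = (1 / card D) * (\<Sum>d\<in>D. LINT x|\<mu>. f (\<phi> M d x))"
    by (simp add: transfer_op_def)
  also have "\<dots> = (LINT x|\<mu>. f x)"
    using self_affine_integral[OF \<mu> D, of f C] f by simp
  finally show ?thesis .
qed

text \<open>The iterates keep their integral while their oscillation between \<open>x\<close> and 0
  tends to 0, so the value at 0 approaches the integral. The sequence does not mention
  \<open>\<mu>\<close>, which is what gives uniqueness.\<close>

lemma transfer_pow_tendsto: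
  fixes f :: "real^'n \<Rightarrow> real"
  assumes \<mu>: "is_self_affine_measure M D \<mu>" and D: "finite D" "D \<noteq> {}"
    and M: "summable_orbits (matrix_inv M)"
    and f: "f \<in> borel_measurable borel" "\<And>x. \<bar>f x\<bar> \<le> C" "\<And>x y. \<bar>f x - f y\<bar> \<le> L * norm (x - y)"
  shows "(\<lambda>n. (transfer_op M D ^^ n) f 0) \<longlonglongrightarrow> (LINT x|\<mu>. f x)"
proof -
  interpret \<mu>: prob_space \<mu> using \<mu> by (simp add: is_self_affine_measure_def)
  have [measurable_cong]: "sets \<mu> = sets borel" using \<mu> by (simp add: is_self_affine_measure_def)
  let ?T = "\<lambda>n. (transfer_op M D ^^ n) f"
  note T = transfer_pow_properties[OF D, of f C L _ M, OF f]
  have [measurable]: "?T n \<in> borel_measurable borel" for n using T by blast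
  have lip: "\<bar>?T n x - ?T n 0\<bar> \<le> L * norm (((*v) (matrix_inv M) ^^ n) x)" for n x
    using T[of n] diff_zero[of x] by metis
  have integrable: "integrable \<mu> (?T n)" for n
    by (rule \<mu>.integrable_const_bound[where B = C]) (use T in auto)
  have int: "(LINT x|\<mu>. ?T n x) = (LINT x|\<mu>. f x)" for n
  proof (induction n)
    case (Suc n)
    then show ?case
      using self_affine_integral_transfer[OF \<mu> D, of "?T n" C] T[of n] by simp
  qed simp
  have "(\<lambda>n. LINT x|\<mu>. ?T n x - ?T n 0) \<longlonglongrightarrow> (LINT x|\<mu>. 0)"
  proof (rule integral_dominated_convergence[where w = "\<lambda>_. 2 * C"])
    show "AE x in \<mu>. (\<lambda>n. ?T n x - ?T n 0) \<longlonglongrightarrow> 0"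
    proof (rule AE_I2)
      fix x
      have "(\<lambda>n. L * norm (((*v) (matrix_inv M) ^^ n) x)) \<longlonglongrightarrow> L * 0"
        by (intro tendsto_mult tendsto_const summable_LIMSEQ_zero)
           (use M in \<open>auto simp: summable_orbits_def\<close>)
      then have "(\<lambda>n. L * norm (((*v) (matrix_inv M) ^^ n) x)) \<longlonglongrightarrow> 0"
        by simp
      then show "(\<lambda>n. ?T n x - ?T n 0) \<longlonglongrightarrow> 0"
        by (rule Lim_null_comparison[rotated]) (use lip in auto)
    qed
    show "AE x in \<mu>. norm (?T n x - ?T n 0) \<le> 2 * C" for n
    proof (rule AE_I2)
      fix x show "norm (?T n x - ?T n 0) \<le> 2 * C"
        using T[of n, THEN conjunct2, THEN conjunct1, THEN spec, of x]
          T[of n, THEN conjunct2, THEN conjunct1, THEN spec, of 0]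
        by (simp add: abs_le_iff) 
    qed
  qed auto
  then have "(\<lambda>n. (LINT x|\<mu>. f x) - ?T n 0) \<longlonglongrightarrow> 0"
    by (simp add: integrable int \<mu>.prob_space)
  then have "(\<lambda>n. (LINT x|\<mu>. f x) - ((LINT x|\<mu>. f x) - ?T n 0)) \<longlonglongrightarrow> (LINT x|\<mu>. f x) - 0"
    by (intro tendsto_diff tendsto_const)
  then show ?thesis by simp
qed

text \<open>Bounded Lipschitz functions decrease to the indicator of a closed set, and closed sets
  are an intersection-stable generator of the Borel sets.\<close>

lemma measure_closed_eqI:
  fixes \<mu> \<nu> :: "'a::heine_borel measure"
  assumes \<mu>: "prob_space \<mu>" "sets \<mu> = sets borel" and \<nu>: "prob_space \<nu>" "sets \<nu> = sets borel"
    and eq: "\<And>f C L. f \<in> borel_measurable borel \<Longrightarrow> (\<And>x. \<bar>f x\<bar> \<le> C) \<Longrightarrow>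
      (\<And>x y. \<bar>f x - f y\<bar> \<le> L * dist x y) \<Longrightarrow> (LINT x|\<mu>. f x) = (LINT x|\<nu>. f x :: real)"
  shows "\<mu> = \<nu>"
proof -
  interpret \<mu>: prob_space \<mu> by fact
  interpret \<nu>: prob_space \<nu> by fact
  have closed: "measure \<mu> A = measure \<nu> A" if A: "closed A" "A \<noteq> {}" for A
  proof -
    \<comment> \<open>A tent of slope \<open>k\<close> over \<open>A\<close>. Nonemptiness matters:
      \<open>infdist\<close> to the empty set is 0 by convention, and every \<open>f k\<close> would
      be constantly 1.\<close>
    define f where "f k x = max 0 (1 - real k * infdist x A)" for k x
    have f_lip: "\<bar>f k x - f k y\<bar> \<le> real k * dist x y" for k x y
    proof -
      have "\<bar>f k x - f k y\<bar> \<le> \<bar>real k * (infdist x A - infdist y A)\<bar>"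
        unfolding f_def by (simp add: algebra_simps)
      also have "\<dots> \<le> real k * dist x y"
        using infdist_triangle_abs[of x A y] by (simp add: abs_mult mult_left_mono)
      finally show ?thesis .
    qed
    have f_bound: "\<bar>f k x\<bar> \<le> 1" for k x
      using infdist_nonneg[of x A] by (simp add: f_def)
    have f_meas [measurable]: "f k \<in> borel_measurable borel" for k
      unfolding f_def[abs_def] by (intro borel_measurable_continuous_onI continuous_intros)
    have f_lim: "(\<lambda>k. f k x) \<longlonglongrightarrow> indicator A x" for x
    proof (cases "x \<in> A")
      case True
      then show ?thesis by (simp add: f_def)
    next
      case False
      then have pos: "infdist x A > 0" using A infdist_pos_not_in_closed by blast
      obtain K :: nat where K: "real K > 1 / infdist x A" using reals_Archimedean2 by blast
      have "f k x = 0" if "k \<ge> K" for k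
      proof -
        have "real k > 1 / infdist x A" using K that by linarith
        then show ?thesis using pos by (simp add: f_def divide_less_eq mult.commute)
      qed
      then show ?thesis
        using False by (intro tendsto_eventually) (auto simp: eventually_sequentially intro!: exI[of _ K])
    qed
    have lim: "(\<lambda>k. LINT x|\<kappa>. f k x) \<longlonglongrightarrow> measure \<kappa> A"
      if "prob_space \<kappa>" and sets: "sets \<kappa> = sets borel" for \<kappa>
    proof -
      interpret \<kappa>: prob_space \<kappa> by fact
      note sets [measurable_cong]
      have [measurable]: "A \<in> sets borel" using A by simp
      have "(\<lambda>k. LINT x|\<kappa>. f k x) \<longlonglongrightarrow> (LINT x|\<kappa>. indicator A x)"
        by (rule integral_dominated_convergence[where w = "\<lambda>_. 1"]) (use f_lim f_bound in auto)
      then show ?thesis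
        using sets_eq_imp_space_eq[OF sets] by simp
    qed
    have "(\<lambda>k. LINT x|\<mu>. f k x) = (\<lambda>k. LINT x|\<nu>. f k x)"
      using eq[OF f_meas f_bound f_lip] by blast
    then show ?thesis
      using lim[OF \<mu>] lim[OF \<nu>] LIMSEQ_unique by metis
  qed
  show ?thesis
  proof (rule measure_eqI_generator_eq[where \<Omega> = UNIV and E = "Collect closed" and A = "\<lambda>_. UNIV"])
    show "Int_stable (Collect closed :: 'a set set)" by (auto simp: Int_stable_def)
    show "emeasure \<mu> X = emeasure \<nu> X" if "X \<in> Collect closed" for X
      using that closed[of X] by (cases "X = {}") (auto simp: \<mu>.emeasure_eq_measure \<nu>.emeasure_eq_measure)
    show "sets \<mu> = sigma_sets UNIV (Collect closed)" "sets \<nu> = sigma_sets UNIV (Collect closed)"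
      using \<mu> \<nu> by (auto simp: borel_eq_closed)
  qed auto
qed

lemma is_self_affine_measure_unique:
  fixes M :: "real^'n^'n"
  assumes \<mu>: "is_self_affine_measure M D \<mu>" and \<nu>: "is_self_affine_measure M D \<nu>"
    and D: "finite D" "D \<noteq> {}" and M: "summable_orbits (matrix_inv M)"
  shows "\<mu> = \<nu>"
proof (rule measure_closed_eqI)
  fix f :: "real^'n \<Rightarrow> real" and C L
  assume f: "f \<in> borel_measurable borel" "\<And>x. \<bar>f x\<bar> \<le> C" "\<And>x y. \<bar>f x - f y\<bar> \<le> L * dist x y"
  show "(LINT x|\<mu>. f x) = (LINT x|\<nu>. f x)"
    using transfer_pow_tendsto[OF \<mu> D M f(1,2), of L] transfer_pow_tendsto[OF \<nu> D M f(1,2), of L] f(3)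
      LIMSEQ_unique by (auto simp: dist_norm)
qed (use \<mu> \<nu> in \<open>auto simp: is_self_affine_measure_def\<close>)

section \<open>Existence through a random series\<close>

lemma matrix_vector_mult_suminf:
  fixes B :: "real^'n^'m"
  assumes "summable f"
  shows "B *v (\<Sum>j. f j) = (\<Sum>j. B *v f j)"
  using bounded_linear.suminf[OF matrix_vector_mul_bounded_linear assms, of B] .

text \<open>The law of the random series \<open>\<Sum>\<^sub>j M\<^sup>-\<^sup>j d\<^sub>j\<close> with independent digits, uniform in \<open>D\<close>, is self-affine.\<close>

lemma is_self_affine_measure_exists:
  fixes M :: "real^'n^'n"
  assumes D: "finite D" "D \<noteq> {}" and M: "summable_orbits (matrix_inv M)"
  shows "\<exists>\<mu>. is_self_affine_measure M D \<mu>"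
proof -
  let ?B = "matrix_inv M"
  \<comment> \<open>Streams lie in \<open>D\<close> only almost surely; sending foreign entries to 0
    makes the series converge for every stream, so that \<open>X\<close> is defined by it
    everywhere.\<close>
  define g where "g d = (if d \<in> D then d else 0)" for d
  define a where "a \<omega> j = ((*v) ?B ^^ j) (?B *v g (\<omega> !! j))" for \<omega> j
  define X where "X \<omega> = (\<Sum>j. a \<omega> j)" for \<omega>
  let ?p = "measure_pmf (pmf_of_set D)"
  let ?S = "stream_space ?p"
  interpret S: prob_space ?S
    by (rule prob_space.prob_space_stream_space) (rule measure_pmf.prob_space_axioms)
  have summable: "summable (a \<omega>)" for \<omega>
  proof -
    have "summable (\<lambda>j. \<Sum>d\<in>insert 0 D. norm (((*v) ?B ^^ j) (?B *v d)))"
      using M by (intro summable_sum) (auto simp: summable_orbits_def)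
    moreover have "norm (a \<omega> j) \<le> (\<Sum>d\<in>insert 0 D. norm (((*v) ?B ^^ j) (?B *v d)))" for j
      unfolding a_def by (rule member_le_sum) (use D in \<open>auto simp: g_def\<close>)
    ultimately show ?thesis
      by (intro summable_comparison_test[of "a \<omega>"]) auto
  qed
  have pow_meas [measurable]: "((*v) ?B ^^ j) \<in> borel_measurable borel" for j
  proof (induction j)
    case (Suc j)
    have "(*v) ?B \<in> borel_measurable borel"
      by (intro borel_measurable_continuous_onI matrix_vector_mult_linear_continuous_on)
    from measurable_comp[OF Suc this] show ?case by (simp add: comp_def)
  qed simp
  have a_meas [measurable]: "(\<lambda>\<omega>. a \<omega> j) \<in> borel_measurable ?S" for j
  proof -
    have "(\<lambda>d. ((*v) ?B ^^ j) (?B *v g d)) \<in> borel_measurable ?p" by simp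
    from measurable_compose[OF measurable_snth this] show ?thesis by (simp add: a_def)
  qed
  have X_meas [measurable]: "X \<in> borel_measurable ?S"
    unfolding X_def[abs_def] by measurable
  \<comment> \<open>Prepending a digit acts on the sum as \<open>\<phi> M d\<close>. Conditioning on
    the first digit of the stream therefore gives the invariance equation.\<close>
  have X_step: "X (d ## \<omega>) = \<phi> M d (X \<omega>)" if "d \<in> D" for d \<omega>
  proof -
    have "X (d ## \<omega>) = a (d ## \<omega>) 0 + (\<Sum>j. a (d ## \<omega>) (Suc j))"
      unfolding X_def using summable suminf_split_head by (simp add: suminf_split_head)
    also have "(\<lambda>j. a (d ## \<omega>) (Suc j)) = (\<lambda>j. ?B *v a \<omega> j)"
      by (simp add: a_def)
    also have "(\<Sum>j. ?B *v a \<omega> j) = ?B *v X \<omega>"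
      unfolding X_def by (rule matrix_vector_mult_suminf[OF summable, symmetric])
    finally show ?thesis
      using that by (simp add: a_def g_def \<phi>_def matrix_vector_right_distrib add.commute)
  qed
  let ?\<mu> = "distr ?S borel X"
  interpret \<mu>: prob_space ?\<mu> by (rule S.prob_space_distr) measurable
  have "measure ?\<mu> A = (1 / real (card D)) * (\<Sum>d\<in>D. measure ?\<mu> (\<phi> M d -` A))"
    if A [measurable]: "A \<in> sets borel" for A
  proof -
    have \<phi>_A [measurable]: "\<phi> M d -` A \<in> sets borel" for d
      using measurable_sets_borel[of "\<phi> M d" borel A] by measurable
    have "emeasure ?\<mu> A = emeasure ?S (X -` A \<inter> space ?S)"
      by (simp add: emeasure_distr)
    also have "\<dots> = (\<integral>\<^sup>+d. emeasure ?S {\<omega>\<in>space ?S. d ## \<omega> \<in> X -` A \<inter> space ?S} \<partial>?p)"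
      by (rule prob_space.emeasure_stream_space[OF measure_pmf.prob_space_axioms]) measurable
    also have "\<dots> = (\<integral>\<^sup>+d. emeasure ?\<mu> (\<phi> M d -` A) \<partial>?p)"
    proof (rule nn_integral_cong_AE, rule AE_pmfI)
      fix d assume "d \<in> set_pmf (pmf_of_set D)"
      then have "d \<in> D" using D by simp
      then have "{\<omega>\<in>space ?S. d ## \<omega> \<in> X -` A \<inter> space ?S} = X -` (\<phi> M d -` A) \<inter> space ?S"
        by (auto simp: X_step space_stream_space)
      then show "emeasure ?S {\<omega>\<in>space ?S. d ## \<omega> \<in> X -` A \<inter> space ?S} = emeasure ?\<mu> (\<phi> M d -` A)"
        by (simp add: emeasure_distr)
    qed
    also have "\<dots> = (\<Sum>d\<in>D. ennreal (measure ?\<mu> (\<phi> M d -` A))) / card D"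
      using D by (simp add: nn_integral_pmf_of_set \<mu>.emeasure_eq_measure)
    also have "\<dots> = ennreal ((\<Sum>d\<in>D. measure ?\<mu> (\<phi> M d -` A)) / real (card D))"
      using D by (subst divide_ennreal[symmetric])
        (auto simp: sum_nonneg card_gt_0_iff ennreal_of_nat_eq_real_of_nat)
    finally show ?thesis
      by (simp add: \<mu>.emeasure_eq_measure sum_nonneg)
  qed
  then have "is_self_affine_measure M D ?\<mu>"
    using \<mu>.prob_space_axioms by (simp add: is_self_affine_measure_def)
  then show ?thesis ..
qed

lemma self_affine_measure_is_self_affine:
  assumes "finite D" "D \<noteq> {}" "summable_orbits (matrix_inv M)"
  shows "is_self_affine_measure M D (self_affine_measure M D)"
  unfolding self_affine_measure_def
  using is_self_affine_measure_exists[OF assms] is_self_affine_measure_unique[OF _ _ assms]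
  by (metis theI)

subsection \<open>Zeros of the Fourier transform\<close>

definition fourier :: "(real^'n) measure \<Rightarrow> real^'n \<Rightarrow> complex" where
  "fourier \<mu> \<xi> = (LINT x|\<mu>. exponential \<xi> x)"

definition digit_mask :: "(real^'n) set \<Rightarrow> real^'n \<Rightarrow> complex" where
  "digit_mask D \<xi> = (1 / card D) *\<^sub>R (\<Sum>d\<in>D. exponential \<xi> d)"

lemma norm_exponential [simp]: "norm (exponential \<xi> x) = 1"
proof -
  have "exponential \<xi> x = exp (\<i> * complex_of_real (2 * pi * (\<xi> \<bullet> x)))"
    by (simp add: exponential_def mult_ac)
  then show ?thesis by (simp only: norm_exp_i_times)
qed

lemma exponential_measurable [measurable]: "exponential \<xi> \<in> borel_measurable borel"
  unfolding exponential_def by (intro borel_measurable_continuous_onI continuous_intros)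

lemma exponential_diff_left: "exponential (\<xi> - \<kappa>) x = exponential \<xi> x * cnj (exponential \<kappa> x)"
  by (simp add: exponential_def inner_diff_left algebra_simps exp_diff exp_cnj exp_minus divide_inverse)

lemma exponential_\<phi>: "exponential \<xi> (\<phi> M d x) =
    exponential (\<xi> v* matrix_inv M) d * exponential (\<xi> v* matrix_inv M) x"
  by (simp add: exponential_def \<phi>_def dot_lmul_matrix[symmetric] inner_add_right exp_add[symmetric] algebra_simps)

lemma orthogonal_in_L2_fourier:
  "orthogonal_in_L2 \<mu> (exponential \<xi>) (exponential \<kappa>) \<longleftrightarrow> fourier \<mu> (\<xi> - \<kappa>) = 0"
  by (simp add: orthogonal_in_L2_def fourier_def exponential_diff_left)

lemma fourier_step:
  assumes \<mu>: "is_self_affine_measure M D \<mu>" and D: "finite D" "D \<noteq> {}"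
  shows "fourier \<mu> \<xi> = digit_mask D (\<xi> v* matrix_inv M) * fourier \<mu> (\<xi> v* matrix_inv M)"
  using self_affine_integral[OF \<mu> D, of "exponential \<xi>" 1]
  by (simp add: fourier_def digit_mask_def exponential_\<phi> sum_distrib_right)

lemma inner_vector_matrix_funpow:
  fixes B :: "real^'n^'n"
  shows "((\<lambda>\<xi>. \<xi> v* B) ^^ n) \<xi> \<bullet> x = \<xi> \<bullet> ((*v) B ^^ n) x"
  by (induction n arbitrary: x) (simp_all add: dot_lmul_matrix funpow_swap1[of "(*v) B"])

text \<open>Moving the matrix powers across the inner product onto \<open>x\<close> makes the phases
  tend to 0 pointwise; dominated convergence does the rest.\<close>

lemma fourier_orbit_tendsto:
  assumes \<mu>: "is_self_affine_measure M D \<mu>" and M: "summable_orbits (matrix_inv M)"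
  shows "(\<lambda>n. fourier \<mu> (((\<lambda>\<xi>. \<xi> v* matrix_inv M) ^^ n) \<xi>)) \<longlonglongrightarrow> 1"
proof -
  interpret \<mu>: prob_space \<mu> using \<mu> by (simp add: is_self_affine_measure_def)
  have [measurable_cong]: "sets \<mu> = sets borel" using \<mu> by (simp add: is_self_affine_measure_def)
  define R where "R n = ((\<lambda>\<xi>. \<xi> v* matrix_inv M) ^^ n) \<xi>" for n
  have "(\<lambda>n. LINT x|\<mu>. exponential (R n) x) \<longlonglongrightarrow> (LINT x|\<mu>. 1)"
  proof (rule integral_dominated_convergence[where w = "\<lambda>_. 1"])
    show "AE x in \<mu>. (\<lambda>n. exponential (R n) x) \<longlonglongrightarrow> 1"
    proof (rule AE_I2)
      fix x
      have "(\<lambda>n. ((*v) (matrix_inv M) ^^ n) x) \<longlonglongrightarrow> 0"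
        by (rule tendsto_norm_zero_cancel, rule summable_LIMSEQ_zero)
          (use M in \<open>simp add: summable_orbits_def\<close>)
      then have "(\<lambda>n. exp (2 * complex_of_real pi * \<i> * of_real (\<xi> \<bullet> ((*v) (matrix_inv M) ^^ n) x)))
          \<longlonglongrightarrow> exp (2 * complex_of_real pi * \<i> * of_real (\<xi> \<bullet> 0))"
        by (intro tendsto_intros)
      then show "(\<lambda>n. exponential (R n) x) \<longlonglongrightarrow> 1"
        by (simp add: exponential_def R_def inner_vector_matrix_funpow)
    qed
  qed auto
  then show ?thesis by (simp add: fourier_def R_def \<mu>.prob_space)
qed

text \<open>If no mask factor vanished, a zero would propagate along the whole contracted orbit,
  where the transform tends to 1. This avoids forming the infinite product.\<close>

lemma fourier_eq_0_iff:
  assumes \<mu>: "is_self_affine_measure M D \<mu>" and D: "finite D" "D \<noteq> {}"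
    and M: "summable_orbits (matrix_inv M)"
  shows "fourier \<mu> \<xi> = 0 \<longleftrightarrow> (\<exists>n. digit_mask D (((\<lambda>\<xi>. \<xi> v* matrix_inv M) ^^ Suc n) \<xi>) = 0)"
proof -
  let ?R = "\<lambda>\<xi>. \<xi> v* matrix_inv M"
  note step = fourier_step[OF \<mu> D]
  show ?thesis
  proof
    assume zero: "fourier \<mu> \<xi> = 0"
    show "\<exists>n. digit_mask D ((?R ^^ Suc n) \<xi>) = 0"
    proof (rule ccontr)
      assume *: "\<not> ?thesis"
      have "fourier \<mu> ((?R ^^ n) \<xi>) = 0" for n
      proof (induction n)
        case (Suc n)
        then show ?case using step[of "(?R ^^ n) \<xi>"] * by auto
      qed (simp add: zero)
      then show False
        using fourier_orbit_tendsto[OF \<mu> M, of \<xi>] by (simp add: LIMSEQ_const_iff)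
    qed
  next
    assume "\<exists>n. digit_mask D ((?R ^^ Suc n) \<xi>) = 0"
    then obtain n where "digit_mask D ((?R ^^ Suc n) \<xi>) = 0" ..
    then show "fourier \<mu> \<xi> = 0"
    proof (induction n arbitrary: \<xi>)
      case 0
      then show ?case using step[of \<xi>] by simp
    next
      case (Suc n)
      have "(?R ^^ Suc (Suc n)) \<xi> = (?R ^^ Suc n) (?R \<xi>)"
        by (simp only: funpow_Suc_right comp_apply)
      with Suc have "fourier \<mu> (?R \<xi>) = 0" by metis
      then show ?case using step[of \<xi>] by simp
    qed
  qed
qed

lemma vector_matrix_funpow_inverse:
  fixes A B :: "real^'n^'n"
  assumes "A ** B = mat 1"
  shows "((\<lambda>\<xi>. \<xi> v* B) ^^ n) (((\<lambda>\<xi>. \<xi> v* A) ^^ n) \<xi>) = \<xi>"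
proof (induction n)
  case (Suc n)
  have "((\<lambda>\<xi>. \<xi> v* B) ^^ Suc n) (((\<lambda>\<xi>. \<xi> v* A) ^^ Suc n) \<xi>)
      = ((\<lambda>\<xi>. \<xi> v* B) ^^ n) (((\<lambda>\<xi>. \<xi> v* A) ^^ n) \<xi> v* A v* B)"
    by (subst funpow_Suc_right) simp
  then show ?case by (simp add: vector_matrix_mul_assoc assms Suc)
qed simp

lemma fourier_eq_0_iff_orbit:
  assumes \<mu>: "is_self_affine_measure M D \<mu>" and D: "finite D" "D \<noteq> {}"
    and M: "summable_orbits (matrix_inv M)"
    and inv: "M ** matrix_inv M = mat 1" "matrix_inv M ** M = mat 1"
  shows "fourier \<mu> \<xi> = 0 \<longleftrightarrow> (\<exists>n s. digit_mask D s = 0 \<and> \<xi> = ((\<lambda>\<xi>. \<xi> v* M) ^^ Suc n) s)"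
proof -
  let ?R = "\<lambda>\<xi>. \<xi> v* matrix_inv M" and ?A = "\<lambda>\<xi>. \<xi> v* M"
  have "digit_mask D ((?R ^^ Suc n) \<xi>) = 0 \<longleftrightarrow> (\<exists>s. digit_mask D s = 0 \<and> \<xi> = (?A ^^ Suc n) s)" for n
    using vector_matrix_funpow_inverse[OF inv(1), of "Suc n"]
      vector_matrix_funpow_inverse[OF inv(2), of "Suc n" \<xi>] by metis
  then show ?thesis
    unfolding fourier_eq_0_iff[OF \<mu> D M] by blast
qed

section \<open>Zeros of the mask of three digits\<close>

lemma exp_sum_eq_0_iff:
  fixes a b :: real
  shows "1 + exp (2 * complex_of_real pi * \<i> * of_real a) + exp (2 * complex_of_real pi * \<i> * of_real b) = 0
    \<longleftrightarrow> (\<exists>(p::int) (m::int). 3 * a = p \<and> a + b = m \<and> \<not> (3::int) dvd p)"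
proof -
  define e where "e x = exp (2 * complex_of_real pi * \<i> * of_real x)" for x :: real
  have e_add: "e (x + y) = e x * e y" for x y by (simp add: e_def algebra_simps exp_add)
  have e_1: "e x = 1 \<longleftrightarrow> (\<exists>n::int. x = n)" for x
    by (auto simp: e_def exp_eq_1)
  have e_cnj: "e x * cnj (e x) = 1" for x
    using e_add[of x "-x"] by (simp add: e_def exp_cnj)
  have e3: "e (3 * x) = e x ^ 3" for x
    using e_add[of x x] e_add[of "x + x" x] by (simp add: power3_eq_cube)
  have "1 + e a + e b = 0 \<longleftrightarrow> e (3 * a) = 1 \<and> e (a + b) = 1 \<and> e a \<noteq> 1"
  proof
    assume *: "1 + e a + e b = 0"
    then have b: "e b = - 1 - e a" by (simp add: algebra_simps add_eq_0_iff)
    \<comment> \<open>Since \<open>e b\<close> has modulus 1, this forces \<open>e a\<close> to have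
      real part -1/2, so \<open>e a\<close> is a primitive cube root of unity and \<open>e b\<close>
      its conjugate.\<close>
    have "(- 1 - e a) * (- 1 - cnj (e a)) = 1" using e_cnj[of b] by (simp add: b)
    then have c: "e a + cnj (e a) = - 1" using e_cnj[of a] by algebra
    then have q: "e a * e a + e a + 1 = 0" using e_cnj[of a] by algebra
    have "e a \<noteq> 1" using q by auto
    moreover have "e a ^ 3 = 1" using q by algebra
    moreover have "e a * e b = 1" using q b by algebra
    ultimately show "e (3 * a) = 1 \<and> e (a + b) = 1 \<and> e a \<noteq> 1"
      by (simp add: e3 e_add)
  next
    assume *: "e (3 * a) = 1 \<and> e (a + b) = 1 \<and> e a \<noteq> 1"
    have "e a ^ 3 = 1" using * e3[of a] by metis
    then have "(e a - 1) * (e a * e a + e a + 1) = 0" by algebra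
    then have q: "e a * e a + e a + 1 = 0" using * by auto
    have "e a * e b = 1" using * by (simp add: e_add)
    then have "e a * (1 + e a + e b) = 0" using q by (simp add: algebra_simps)
    then show "1 + e a + e b = 0" using e_cnj[of a] by auto
  qed
  also have "\<dots> \<longleftrightarrow> (\<exists>(p::int) (m::int). 3 * a = p \<and> a + b = m \<and> \<not> (3::int) dvd p)"
  proof -
    have "(\<exists>n::int. a = n) \<longleftrightarrow> (3::int) dvd p" if "3 * a = of_int p" for p
    proof
      assume "\<exists>n::int. a = n"
      then obtain n :: int where "a = n" ..
      then have "p = 3 * n" using that by linarith
      then show "3 dvd p" by simp
    qed (use that in \<open>auto simp: dvd_def\<close>)
    then show ?thesis unfolding e_1 by metis
  qed
  finally show ?thesis by (simp add: e_def)
qed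

lemma digit_mask_eq_0_iff:
  fixes a b :: "real^'n"
  assumes "a \<noteq> 0" "b \<noteq> 0" "a \<noteq> b"
  shows "digit_mask {0, a, b} \<xi> = 0 \<longleftrightarrow>
    (\<exists>(p::int) (m::int). 3 * (\<xi> \<bullet> a) = p \<and> \<xi> \<bullet> a + \<xi> \<bullet> b = m \<and> \<not> (3::int) dvd p)"
  unfolding exp_sum_eq_0_iff[symmetric]
  using assms by (simp add: digit_mask_def exponential_def add.assoc inner_commute)

subsection \<open>Orbits of the inverse Fibonacci matrix modulo powers of 3\<close>

text \<open>The inverse of half of \<open>fib_matrix\<close>, acting on integer pairs; the inverse
  stays integral because the Fibonacci matrix has determinant -1.\<close>

definition inverse_fib :: "int \<times> int \<Rightarrow> int \<times> int" where
  "inverse_fib = (\<lambda>(x, y). (y, x - y))"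

text \<open>The element \<open>c + d * F\<close> of the commutative ring generated by F =
  \<open>inverse_fib\<close>, where F^2 = 1 - F.\<close>

definition fib_lin :: "int \<Rightarrow> int \<Rightarrow> int \<times> int \<Rightarrow> int \<times> int" where
  "fib_lin c d = (\<lambda>(x, y). (c * x + d * y, c * y + d * (x - y)))"

lemma fib_lin_comp: "fib_lin c d \<circ> fib_lin c' d' = fib_lin (c * c' + d * d') (c * d' + d * c' - d * d')"
  by (auto simp: fib_lin_def fun_eq_iff algebra_simps)

lemma not_3_dvd_cases: "\<not> (3::int) dvd x \<longleftrightarrow> x mod 3 = 1 \<or> x mod 3 = 2"
  by presburger

lemma not_3_dvd_square: "\<not> (3::int) dvd x \<Longrightarrow> 3 dvd x * x - 1"
  by (auto simp: not_3_dvd_cases mod_eq_dvd_iff[symmetric] mod_mult_eq[symmetric, of x x])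

lemma prime_3_int: "prime (3::int)"
proof -
  have "{2..<3::int} = {2}" by auto
  then show ?thesis by (simp add: prime_int_iff')
qed

text \<open>Starts from F^4 = 2 - 3 F. Cubing a scalar plus a multiple of F divisible by 3 gains
  exactly one factor 3 in that multiple.\<close>

lemma inverse_fib_power:
  "\<exists>c e. inverse_fib ^^ (4 * 3 ^ n) = fib_lin c (3 ^ Suc n * e) \<and> \<not> 3 dvd c \<and> \<not> 3 dvd e"
proof (induction n)
  case 0
  have "inverse_fib ^^ 4 = fib_lin 2 (-3)"
    by (auto simp: fun_eq_iff numeral_eq_Suc inverse_fib_def fib_lin_def)
  then show ?case by (intro exI[of _ 2] exI[of _ "-1"]) auto
next
  case (Suc n)
  then obtain c e where IH: "inverse_fib ^^ (4 * 3 ^ n) = fib_lin c (3 ^ Suc n * e)" and ce: "\<not> 3 dvd c" "\<not> 3 dvd e"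
    by auto
  have cube: "g ^^ 3 = g \<circ> (g \<circ> g)" for g :: "int \<times> int \<Rightarrow> int \<times> int"
    by (simp add: numeral_eq_Suc comp_assoc)
  define q :: int where "q = 3 ^ n"
  \<comment> \<open>Both coefficients come from expanding the cube of
    \<open>c + 3 * q * e * F\<close> with F^2 = 1 - F. Modulo 3 they are \<open>c ^ 3\<close> and
    \<open>c\<^sup>2 * e\<close>, hence units.\<close>
  define c' where "c' = c ^ 3 + 3 * (c * (3 * q * e)\<^sup>2 - 9 * q ^ 3 * e ^ 3)"
  define e' where "e' = c\<^sup>2 * e + 3 * (2 * q\<^sup>2 * e ^ 3 - q * c * e\<^sup>2)"
  have "inverse_fib ^^ (4 * 3 ^ Suc n) = (inverse_fib ^^ (4 * 3 ^ n)) ^^ 3"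
    by (simp add: funpow_mult mult_ac)
  also have "\<dots> = fib_lin c (3 * q * e) \<circ> (fib_lin c (3 * q * e) \<circ> fib_lin c (3 * q * e))"
    by (simp add: IH cube q_def comp_assoc)
  also have "\<dots> = fib_lin c' (3 ^ Suc (Suc n) * e')"
    unfolding fib_lin_comp
    by (rule arg_cong2[where f = fib_lin])
       (simp_all add: c'_def e'_def q_def[symmetric] algebra_simps power2_eq_square power3_eq_cube)
  finally have "inverse_fib ^^ (4 * 3 ^ Suc n) = fib_lin c' (3 ^ Suc (Suc n) * e')" .
  moreover have "\<not> 3 dvd c'"
    using ce prime_3_int by (auto simp: c'_def dvd_add_left_iff dest: prime_dvd_power[OF prime_3_int])
  moreover have "\<not> 3 dvd e'"
    using ce prime_3_int by (auto simp: e'_def dvd_add_left_iff prime_dvd_mult_iff dest: prime_dvd_power[OF prime_3_int])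
  ultimately show ?case by blast
qed

text \<open>Squares are 0 or 1 modulo 3, so -1 is not a square there.\<close>

lemma sum_of_squares_mod_3:
  fixes x y :: int
  assumes "3 dvd x * x + y * y"
  shows "3 dvd x \<and> 3 dvd y"
proof -
  have "3 dvd p \<and> 3 dvd q" if "3 dvd p + q" "3 dvd p \<or> 3 dvd p - 1" "3 dvd q \<or> 3 dvd q - 1" for p q :: int
    using that by presburger
  moreover have "3 dvd z * z \<or> 3 dvd z * z - 1" for z :: int
    by (cases "3 dvd z") (simp_all add: not_3_dvd_square)
  ultimately have "3 dvd x * x \<and> 3 dvd y * y"
    using assms by blast
  then show ?thesis using prime_3_int by (simp add: prime_dvd_mult_iff)
qed

text \<open>The form is the determinant of \<open>(x, y)\<close> and its image under
  \<open>inverse_fib\<close>; completing the square modulo 3 turns it into a sum of two squares. So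
  there is no eigenvector modulo 3.\<close>

lemma fib_norm_not_dvd:
  fixes x y :: int
  assumes "\<not> (3 dvd x \<and> 3 dvd y)"
  shows "\<not> 3 dvd x * (x - y) - y * y"
proof
  assume *: "3 dvd x * (x - y) - y * y"
  have "(x + y) * (x + y) + y * y = (x * (x - y) - y * y) + 3 * (x * y + y * y)"
    by (simp add: algebra_simps)
  then have "3 dvd (x + y) * (x + y) + y * y" using * by (metis dvd_add dvd_triv_left)
  then have "3 dvd x + y \<and> 3 dvd y" by (rule sum_of_squares_mod_3)
  then show False using assms by presburger
qed

text \<open>Cramer's rule: the determinant of \<open>v\<close> and its image is the norm form, a unit modulo 3.\<close>

lemma fib_basis:
  fixes v1 v2 w1 w2 :: int
  assumes "\<not> (3 dvd v1 \<and> 3 dvd v2)"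
  obtains a b u1 u2 where "w1 = a * v1 + b * v2 + 3 * u1" "w2 = a * v2 + b * (v1 - v2) + 3 * u2"
proof -
  define N where "N = v1 * (v1 - v2) - v2 * v2"
  \<comment> \<open>\<open>N\<close> is its own inverse modulo 3, so multiplying by \<open>N\<close>
    replaces the division in Cramer's rule.\<close>
  obtain k where k: "N * N = 1 + 3 * k"
    using not_3_dvd_square[OF fib_norm_not_dvd[OF assms]] by (auto simp: N_def dvd_def algebra_simps)
  define a b where "a = N * (w1 * (v1 - v2) - w2 * v2)" and "b = N * (v1 * w2 - v2 * w1)"
  have "a * v1 + b * v2 = N * N * w1" "a * v2 + b * (v1 - v2) = N * N * w2"
    by (simp_all add: a_def b_def N_def algebra_simps)
  then have "w1 = a * v1 + b * v2 + 3 * (- k * w1)" "w2 = a * v2 + b * (v1 - v2) + 3 * (- k * w2)"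
    by (simp_all add: k algebra_simps)
  then show thesis by (rule that)
qed

text \<open>Modulo 3, \<open>v\<close> is \<open>a + b * F\<close> applied to \<open>y\<close>. The
  projective line over the field of 3 elements has four points, and 1, F, F^2, F^3 represent all of
  them.\<close>

lemma inverse_fib_orbit_mod_3:
  assumes y: "\<not> (3 dvd y1 \<and> 3 dvd y2)" and v: "\<not> (3 dvd v1 \<and> 3 dvd v2)"
  shows "\<exists>j t w1 w2. (inverse_fib ^^ j) (y1, y2) = (t * v1 + 3 * w1, t * v2 + 3 * w2) \<and> \<not> 3 dvd t"
proof -
  obtain a b u1 u2 where u: "v1 = a * y1 + b * y2 + 3 * u1" "v2 = a * y2 + b * (y1 - y2) + 3 * u2"
    using fib_basis[OF y] .
  have "\<not> (3 dvd a \<and> 3 dvd b)"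
    using v unfolding u by auto
  \<comment> \<open>For each of the four powers \<open>c + d * F\<close>, the pair
    \<open>(a, b)\<close> may match up to the unit \<open>t = 1\<close> or
    \<open>t = 2\<close>.\<close>
  then have cases: "(1 * a - 1) mod 3 = 0 \<and> (1 * b - 0) mod 3 = 0 \<or> (2 * a - 1) mod 3 = 0 \<and> (2 * b - 0) mod 3 = 0 \<or>
      (1 * a - 0) mod 3 = 0 \<and> (1 * b - 1) mod 3 = 0 \<or> (2 * a - 0) mod 3 = 0 \<and> (2 * b - 1) mod 3 = 0 \<or>
      (1 * a - 1) mod 3 = 0 \<and> (1 * b - -1) mod 3 = 0 \<or> (2 * a - 1) mod 3 = 0 \<and> (2 * b - -1) mod 3 = 0 \<or>
      (1 * a - -1) mod 3 = 0 \<and> (1 * b - 2) mod 3 = 0 \<or> (2 * a - -1) mod 3 = 0 \<and> (2 * b - 2) mod 3 = 0"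
    by presburger
  have orbit: ?thesis if ac: "(t * a - c) mod 3 = 0" and bd: "(t * b - d) mod 3 = 0" and t: "\<not> 3 dvd t"
    and pow: "inverse_fib ^^ j = fib_lin c d" for t c d j
  proof -
    obtain p q where "t * a - c = 3 * p" "t * b - d = 3 * q"
      using ac bd by (auto simp: dvd_eq_mod_eq_0[symmetric] elim!: dvdE)
    then have c: "c = t * a - 3 * p" "d = t * b - 3 * q" by auto
    have "(inverse_fib ^^ j) (y1, y2) = (t * v1 + 3 * (- p * y1 - q * y2 - t * u1), t * v2 + 3 * (- p * y2 - q * (y1 - y2) - t * u2))"
      unfolding pow u c by (simp add: fib_lin_def algebra_simps)
    then show ?thesis using t by blast
  qed
  have pow: "inverse_fib ^^ 0 = fib_lin 1 0" "inverse_fib ^^ 1 = fib_lin 0 1"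
    "inverse_fib ^^ 2 = fib_lin 1 (-1)" "inverse_fib ^^ 3 = fib_lin (-1) 2"
    by (auto simp: fun_eq_iff numeral_eq_Suc inverse_fib_def fib_lin_def)
  from cases show ?thesis
  proof (elim disjE conjE)
  qed (rule orbit[OF _ _ _ pow(1)] orbit[OF _ _ _ pow(2)] orbit[OF _ _ _ pow(3)] orbit[OF _ _ _ pow(4)],
      assumption, assumption, simp)+
qed

text \<open>The update of \<open>(t, b)\<close> to \<open>(c * t, e * t + c * b)\<close> adds the
  nonzero residue \<open>e / c\<close> to \<open>b / t\<close> modulo 3, so one of three consecutive
  values vanishes.\<close>

lemma fib_orbit_correction:
  fixes b c e t :: int
  assumes "\<not> 3 dvd c" "\<not> 3 dvd e" "\<not> 3 dvd t"
  shows "3 dvd b \<or> 3 dvd e * t + c * b \<or> 3 dvd e * (c * t) + c * (e * t + c * b)"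
proof (rule ccontr)
  assume *: "\<not> ?thesis"
  have "\<not> 3 dvd e * t" "\<not> 3 dvd c * b"
    using assms * prime_3_int by (auto simp: prime_dvd_mult_iff)
  then have "3 dvd e * t - c * b" using * by presburger
  then have "3 dvd c * (2 * (e * t - c * b) + 3 * (c * b))"
    by (rule dvd_mult[OF dvd_add[OF dvd_mult dvd_triv_left]])
  also have "c * (2 * (e * t - c * b) + 3 * (c * b)) = e * (c * t) + c * (e * t + c * b)"
    by algebra
  finally show False using * by simp
qed

text \<open>Lifting from one power of 3 to the next: the power of F that is scalar modulo
  \<open>3 ^ Suc n\<close> keeps the congruence already reached and is applied at most twice to
  remove the next error digit.\<close>

lemma inverse_fib_orbit:
  assumes y: "\<not> (3 dvd y1 \<and> 3 dvd y2)" and v: "\<not> (3 dvd v1 \<and> 3 dvd v2)"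
  shows "\<exists>j t w1 w2. (inverse_fib ^^ j) (y1, y2) = (t * v1 + 3 ^ Suc n * w1, t * v2 + 3 ^ Suc n * w2)
           \<and> \<not> 3 dvd t"
proof (induction n)
  case 0
  then show ?case using inverse_fib_orbit_mod_3[OF y v] by simp
next
  case (Suc n)
  \<comment> \<open>\<open>b\<close> is the coefficient of the image of \<open>v\<close> under
    \<open>inverse_fib\<close> in the error at level \<open>3 ^ Suc n\<close>; the component along
    \<open>v\<close> itself is kept in \<open>t\<close>.\<close>
  define R where "R t b \<longleftrightarrow> (\<exists>j w1 w2. (inverse_fib ^^ j) (y1, y2) =
      (t * v1 + 3 ^ Suc n * (b * v2 + 3 * w1), t * v2 + 3 ^ Suc n * (b * (v1 - v2) + 3 * w2)))" for t b
  obtain c e where L: "inverse_fib ^^ (4 * 3 ^ n) = fib_lin c (3 ^ Suc n * e)"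
    and ce: "\<not> 3 dvd c" "\<not> 3 dvd e"
    using inverse_fib_power by blast
  have step: "R (c * t) (e * t + c * b)" if R: "R t b" for t b
  proof -
    obtain j w1 w2 where j: "(inverse_fib ^^ j) (y1, y2) =
      (t * v1 + 3 ^ Suc n * (b * v2 + 3 * w1), t * v2 + 3 ^ Suc n * (b * (v1 - v2) + 3 * w2))"
      using R unfolding R_def by blast
    define q :: int where "q = 3 ^ n"
    have "(inverse_fib ^^ (4 * 3 ^ n + j)) (y1, y2) =
       (c * t * v1 + 3 ^ Suc n * ((e * t + c * b) * v2 + 3 * (c * w1 + q * e * (b * (v1 - v2) + 3 * w2))),
        c * t * v2 + 3 ^ Suc n * ((e * t + c * b) * (v1 - v2) +
          3 * (c * w2 + q * e * (b * v2 + 3 * w1) - q * e * (b * (v1 - v2) + 3 * w2))))"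
    proof -
      have "(inverse_fib ^^ (4 * 3 ^ n + j)) (y1, y2) = fib_lin c (3 ^ Suc n * e) ((inverse_fib ^^ j) (y1, y2))"
        by (simp only: funpow_add comp_apply L)
      then show ?thesis
        unfolding j by (simp add: fib_lin_def q_def[symmetric] algebra_simps)
    qed
    then show ?thesis unfolding R_def by blast
  qed
  from Suc obtain j t w1 w2 where
    j: "(inverse_fib ^^ j) (y1, y2) = (t * v1 + 3 ^ Suc n * w1, t * v2 + 3 ^ Suc n * w2)" and t: "\<not> 3 dvd t"
    by blast
  obtain a b u1 u2 where w: "w1 = a * v1 + b * v2 + 3 * u1" "w2 = a * v2 + b * (v1 - v2) + 3 * u2"
    using fib_basis[OF v] .
  \<comment> \<open>The component \<open>a\<close> of the error along \<open>v\<close> moves into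
    the scalar, which changes only by a multiple of 3.\<close>
  have "(inverse_fib ^^ j) (y1, y2) =
      ((t + 3 ^ Suc n * a) * v1 + 3 ^ Suc n * (b * v2 + 3 * u1), (t + 3 ^ Suc n * a) * v2 + 3 ^ Suc n * (b * (v1 - v2) + 3 * u2))"
    unfolding j w by (simp add: algebra_simps)
  then have R: "R (t + 3 ^ Suc n * a) b" unfolding R_def by blast
  have "\<exists>t b. R t b \<and> 3 dvd b \<and> \<not> 3 dvd t"
  proof -
    define s where "s = t + 3 ^ Suc n * a"
    have s: "\<not> 3 dvd s" using t by (simp add: s_def dvd_add_left_iff)
    have nd: "\<not> 3 dvd c * z" if "\<not> 3 dvd z" for z
      using ce that prime_3_int by (simp add: prime_dvd_mult_iff)
    have "R s b" using R by (simp add: s_def)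
    moreover note step[OF this] step[OF step[OF this]]
    ultimately show ?thesis
      using fib_orbit_correction[OF ce s, of b] s nd[OF s] nd[OF nd[OF s]] by blast
  qed
  then obtain t b where "R t (3 * b)" and t: "\<not> 3 dvd t" by (auto elim: dvdE)
  then obtain j w1 w2 where "(inverse_fib ^^ j) (y1, y2) =
      (t * v1 + 3 ^ Suc n * (3 * b * v2 + 3 * w1), t * v2 + 3 ^ Suc n * (3 * b * (v1 - v2) + 3 * w2))"
    unfolding R_def by blast
  then have "(inverse_fib ^^ j) (y1, y2) =
      (t * v1 + 3 ^ Suc (Suc n) * (b * v2 + w1), t * v2 + 3 ^ Suc (Suc n) * (b * (v1 - v2) + w2))"
    by (simp add: algebra_simps)
  then show ?case using t by blast
qed

subsection \<open>Orthogonal exponentials for three digits\<close>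

definition nondivisible :: "int \<Rightarrow> real \<Rightarrow> real^2 \<Rightarrow> bool" where
  "nondivisible N c x \<longleftrightarrow> (\<exists>y1 y2 :: int. c * x$1 = of_int y1 \<and> c * x$2 = of_int y2 \<and> \<not> (N dvd y1 \<and> N dvd y2))"

text \<open>Applying the adjugate to the image returns \<open>det M * y1\<close> and
  \<open>det M * y2\<close>, and \<open>det M\<close> cancels modulo \<open>N\<close>.\<close>

lemma nondivisible_real_mat:
  fixes M :: "int^2^2"
  assumes x: "nondivisible N c x" and coprime: "coprime N (det M)"
  shows "nondivisible N c (x v* real_mat M)"
proof -
  obtain y1 y2 :: int where y: "c * x$1 = of_int y1" "c * x$2 = of_int y2" "\<not> (N dvd y1 \<and> N dvd y2)"
    using x by (auto simp: nondivisible_def)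
  define z1 z2 where "z1 = M$1$1 * y1 + M$2$1 * y2" and "z2 = M$1$2 * y1 + M$2$2 * y2"
  have "c * (x v* real_mat M)$1 = of_int (M$1$1) * (c * x$1) + of_int (M$2$1) * (c * x$2)"
    "c * (x v* real_mat M)$2 = of_int (M$1$2) * (c * x$1) + of_int (M$2$2) * (c * x$2)"
    by (simp_all add: vector_matrix_mult_def sum_2 map_matrix_def algebra_simps)
  then have "c * (x v* real_mat M)$1 = of_int z1" "c * (x v* real_mat M)$2 = of_int z2"
    by (simp_all add: y z1_def z2_def)
  moreover have "\<not> (N dvd z1 \<and> N dvd z2)"
  proof
    assume z: "N dvd z1 \<and> N dvd z2"
    have "N dvd M$2$2 * z1 - M$2$1 * z2" "N dvd M$1$1 * z2 - M$1$2 * z1"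
      using z by (auto intro!: dvd_diff dvd_mult)
    moreover have "M$2$2 * z1 - M$2$1 * z2 = det M * y1" "M$1$1 * z2 - M$1$2 * z1 = det M * y2"
      by (simp_all add: z1_def z2_def det_2 algebra_simps)
    ultimately show False
      using y(3) coprime by (metis coprime_dvd_mult_right_iff)
  qed
  ultimately show ?thesis by (auto simp: nondivisible_def)
qed

lemma nondivisible_orbit:
  fixes M :: "int^2^2"
  assumes "nondivisible N c x" "coprime N (det M)"
  shows "nondivisible N c (((\<lambda>\<xi>. \<xi> v* real_mat M) ^^ n) x)"
  by (induction n) (use assms nondivisible_real_mat in auto)

text \<open>Only differences of frequencies are known to be integral after scaling, so all are
  measured from a base point \<open>\<xi>0\<close>; the residues modulo \<open>N\<close> of the two
  coordinates then separate them.\<close>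

lemma nondivisible_differences_card:
  fixes \<Lambda> :: "(real^2) set"
  assumes N: "N > 0"
    and diff: "\<And>\<xi> \<kappa>. \<xi> \<in> \<Lambda> \<Longrightarrow> \<kappa> \<in> \<Lambda> \<Longrightarrow> \<xi> \<noteq> \<kappa> \<Longrightarrow> nondivisible N c (\<xi> - \<kappa>)"
  shows "finite \<Lambda> \<and> card \<Lambda> \<le> nat N ^ 2"
proof (cases "\<Lambda> = {}")
  case False
  then obtain \<xi>0 where \<xi>0: "\<xi>0 \<in> \<Lambda>" by auto
  define g where "g \<xi> i = \<lfloor>c * (\<xi> - \<xi>0)$i\<rfloor>" for \<xi> i
  have g: "of_int (g \<xi> i) = c * (\<xi> - \<xi>0)$i" if "\<xi> \<in> \<Lambda>" for \<xi> i
  proof (cases "\<xi> = \<xi>0")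
    case False
    then show ?thesis
      using diff[OF that \<xi>0 False] exhaust_2[of i] by (auto simp: nondivisible_def g_def)
  qed (simp add: g_def)
  define f where "f \<xi> = (g \<xi> 1 mod N, g \<xi> 2 mod N)" for \<xi>
  have inj: "inj_on f \<Lambda>"
  proof (rule inj_onI, rule ccontr)
    fix \<xi> \<kappa> assume *: "\<xi> \<in> \<Lambda>" "\<kappa> \<in> \<Lambda>" "f \<xi> = f \<kappa>" "\<xi> \<noteq> \<kappa>"
    obtain y1 y2 :: int where y: "c * (\<xi> - \<kappa>)$1 = of_int y1" "c * (\<xi> - \<kappa>)$2 = of_int y2" "\<not> (N dvd y1 \<and> N dvd y2)"
      using diff[OF *(1,2,4)] by (auto simp: nondivisible_def)
    have "of_int (g \<xi> i - g \<kappa> i) = c * (\<xi> - \<kappa>)$i" for i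
      using * by (simp add: g algebra_simps)
    then have "y1 = g \<xi> 1 - g \<kappa> 1" "y2 = g \<xi> 2 - g \<kappa> 2"
      using y by (metis of_int_eq_iff)+
    then show False
      using *(3) y(3) by (auto simp: f_def mod_eq_dvd_iff)
  qed
  have sub: "f ` \<Lambda> \<subseteq> {0..<N} \<times> {0..<N}"
    using N by (auto simp: f_def)
  have "finite \<Lambda>" "card \<Lambda> \<le> card ({0..<N} \<times> {0..<N})"
    using inj_on_finite[OF inj sub] card_inj_on_le[OF inj sub] by auto
  then show ?thesis by (simp add: card_cartesian_product power2_eq_square)
qed simp

section \<open>Orthogonal families and mask zeros for three digits\<close>

definition real_pair :: "int \<times> int \<Rightarrow> real^2" where
  "real_pair y = vector [of_int (fst y), of_int (snd y)]"

lemma real_pair_nth [simp]: "real_pair y $ 1 = of_int (fst y)" "real_pair y $ 2 = of_int (snd y)"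
  by (simp_all add: real_pair_def)

lemma fib_matrix_inverse_fib:
  "((\<lambda>\<xi>. \<xi> v* real_mat fib_matrix) ^^ j) (c *\<^sub>R real_pair ((inverse_fib ^^ j) y)) = (c * 2 ^ j) *\<^sub>R real_pair y"
proof (induction j arbitrary: y)
  case (Suc j)
  have "((\<lambda>\<xi>. \<xi> v* real_mat fib_matrix) ^^ Suc j) (c *\<^sub>R real_pair ((inverse_fib ^^ Suc j) y))
     = ((c * 2 ^ j) *\<^sub>R real_pair (inverse_fib y)) v* real_mat fib_matrix"
    using Suc[of "inverse_fib y"] by (simp add: funpow_swap1)
  also have "\<dots> = (c * 2 ^ Suc j) *\<^sub>R real_pair y"
    by (simp add: vec_eq_iff forall_2 vector_matrix_mult_def sum_2 map_matrix_def fib_matrix_def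
        inverse_fib_def split_beta algebra_simps)
  finally show ?case .
qed simp

locale three_digits =
  fixes a1 a2 b1 b2 :: int
  assumes det_nonzero: "a1 * b2 - a2 * b1 \<noteq> 0"
begin

definition digits :: "(real^2) set" where
  "digits = {vector [0, 0], vector [of_int a1, of_int a2], vector [of_int b1, of_int b2]}"

definition mask_zero :: "real^2 \<Rightarrow> bool" where
  "mask_zero x \<longleftrightarrow> (\<exists>p m :: int.
     3 * (x$1 * of_int a1 + x$2 * of_int a2) = of_int p \<and>
     x$1 * of_int a1 + x$2 * of_int a2 + (x$1 * of_int b1 + x$2 * of_int b2) = of_int m \<and> \<not> (3::int) dvd p)"

lemma mask_digits_eq_0: "digit_mask digits x = 0 \<longleftrightarrow> mask_zero x"
proof -
  have "digits = {0, vector [of_int a1, of_int a2], vector [of_int b1, of_int b2]}"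
  proof -
    have "vector [0, 0] = (0 :: real^2)" by (simp add: vec_eq_iff forall_2)
    then show ?thesis by (simp add: digits_def)
  qed
  moreover have "vector [of_int a1, of_int a2] \<noteq> (0 :: real^2)" "vector [of_int b1, of_int b2] \<noteq> (0 :: real^2)"
    "vector [of_int a1, of_int a2] \<noteq> (vector [of_int b1, of_int b2] :: real^2)"
    using det_nonzero by (auto simp: vec_eq_iff forall_2)
  ultimately show ?thesis
    by (simp add: digit_mask_eq_0_iff mask_zero_def inner_vec_def sum_2)
qed

lemma fourier_eq_0:
  assumes M: "expanding (real_mat M)" "det M \<noteq> 0"
  shows "fourier (self_affine_measure (real_mat M) digits) \<xi> = 0 \<longleftrightarrow>
    (\<exists>n s. mask_zero s \<and> \<xi> = ((\<lambda>\<xi>. \<xi> v* real_mat M) ^^ Suc n) s)"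
proof -
  have det: "det (real_mat M) \<noteq> 0" using M by (simp add: det_real_mat_2)
  have D: "finite digits" "digits \<noteq> {}" by (auto simp: digits_def)
  have S: "summable_orbits (matrix_inv (real_mat M))"
    using M det by (intro expanding_summable_orbits_inv)
  show ?thesis
    using fourier_eq_0_iff_orbit[OF self_affine_measure_is_self_affine[OF D S] D S matrix_inv_mul[OF det]]
    by (simp only: mask_digits_eq_0)
qed

lemma at_most_orthogonal:
  assumes M: "expanding (real_mat M)" "det M \<noteq> 0" and N: "N > 0" "coprime N (det M)"
    and zero: "\<And>s. mask_zero s \<Longrightarrow> nondivisible N c s"
  shows "at_most_orthogonal_exponentials (self_affine_measure (real_mat M) digits) (nat N ^ 2)"
  unfolding at_most_orthogonal_exponentials_def
proof (intro allI impI)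
  fix \<Lambda> assume orth: "orthogonal_exponentials (self_affine_measure (real_mat M) digits) \<Lambda>"
  show "finite \<Lambda> \<and> card \<Lambda> \<le> nat N ^ 2"
  proof (rule nondivisible_differences_card[OF N(1)])
    fix \<xi> \<kappa> assume "\<xi> \<in> \<Lambda>" "\<kappa> \<in> \<Lambda>" "\<xi> \<noteq> \<kappa>"
    then have "fourier (self_affine_measure (real_mat M) digits) (\<xi> - \<kappa>) = 0"
      using orth by (simp add: orthogonal_exponentials_def orthogonal_in_L2_fourier)
    then obtain n s where "mask_zero s" and eq: "\<xi> - \<kappa> = ((\<lambda>\<xi>. \<xi> v* real_mat M) ^^ Suc n) s"
      unfolding fourier_eq_0[OF M] by blast
    then show "nondivisible N c (\<xi> - \<kappa>)"
      unfolding eq using zero N by (intro nondivisible_orbit) auto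
  qed
qed

text \<open>Being a mask zero survives integer translations and multipliers prime to 3; this is why
  transitivity modulo \<open>3 ^ Suc m\<close> and up to such multipliers is enough.\<close>

lemma mask_zero_scale_add:
  assumes x: "mask_zero x" and t: "\<not> 3 dvd t"
  shows "mask_zero (of_int t *\<^sub>R x + real_pair u)"
proof -
  obtain p m :: int where
    p: "3 * (x$1 * of_int a1 + x$2 * of_int a2) = of_int p" and
    m: "x$1 * of_int a1 + x$2 * of_int a2 + (x$1 * of_int b1 + x$2 * of_int b2) = of_int m"
    and np: "\<not> (3::int) dvd p"
    using x by (auto simp: mask_zero_def)
  let ?u1 = "fst u" and ?u2 = "snd u" and ?y = "of_int t *\<^sub>R x + real_pair u"
  have "3 * (?y$1 * of_int a1 + ?y$2 * of_int a2) =
      of_int t * (3 * (x$1 * of_int a1 + x$2 * of_int a2)) + of_int (3 * (?u1 * a1 + ?u2 * a2))"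
    by (simp add: algebra_simps)
  also have "\<dots> = of_int (t * p + 3 * (?u1 * a1 + ?u2 * a2))" by (simp flip: p)
  finally have 1: "3 * (?y$1 * of_int a1 + ?y$2 * of_int a2) = of_int (t * p + 3 * (?u1 * a1 + ?u2 * a2))" .
  have "?y$1 * of_int a1 + ?y$2 * of_int a2 + (?y$1 * of_int b1 + ?y$2 * of_int b2) =
      of_int t * (x$1 * of_int a1 + x$2 * of_int a2 + (x$1 * of_int b1 + x$2 * of_int b2))
      + of_int (?u1 * a1 + ?u2 * a2 + (?u1 * b1 + ?u2 * b2))"
    by (simp add: algebra_simps)
  also have "\<dots> = of_int (t * m + (?u1 * a1 + ?u2 * a2 + (?u1 * b1 + ?u2 * b2)))" by (simp flip: m)
  finally have 2: "?y$1 * of_int a1 + ?y$2 * of_int a2 + (?y$1 * of_int b1 + ?y$2 * of_int b2) =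
    of_int (t * m + (?u1 * a1 + ?u2 * a2 + (?u1 * b1 + ?u2 * b2)))" .
  have "\<not> 3 dvd t * p + 3 * (?u1 * a1 + ?u2 * a2)"
    using np t prime_3_int by (simp add: dvd_add_left_iff prime_dvd_mult_iff)
  with 1 2 show ?thesis unfolding mask_zero_def by blast
qed

lemma orbit_meets_mask_zero:
  assumes d: "\<not> (3 dvd fst d \<and> 3 dvd snd d)" and s: "\<not> (3 dvd fst s \<and> 3 dvd snd s)"
    and zero: "mask_zero ((1 / 3 ^ Suc m) *\<^sub>R real_pair s)"
  shows "\<exists>j. \<forall>J\<ge>j. \<exists>n x. mask_zero x \<and>
    (2 ^ J / 3 ^ Suc m) *\<^sub>R real_pair d = ((\<lambda>\<xi>. \<xi> v* real_mat fib_matrix) ^^ Suc n) x"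
proof -
  \<comment> \<open>One backward step is taken in advance, because a zero of the transform lies at
    least one forward step away from a mask zero.\<close>
  have "\<not> (3 dvd fst (inverse_fib d) \<and> 3 dvd snd (inverse_fib d))"
    using d by (simp add: inverse_fib_def split_beta) presburger
  from inverse_fib_orbit[OF this s, of m] obtain i t w1 w2 where
    i: "(inverse_fib ^^ i) (inverse_fib d) = (t * fst s + 3 ^ Suc m * w1, t * snd s + 3 ^ Suc m * w2)"
    and t: "\<not> 3 dvd t" by auto
  have "\<exists>n x. mask_zero x \<and>
    (2 ^ J / 3 ^ Suc m) *\<^sub>R real_pair d = ((\<lambda>\<xi>. \<xi> v* real_mat fib_matrix) ^^ Suc n) x"
    if J: "J \<ge> Suc i" for J
  proof (intro exI conjI)
    let ?k = "J - Suc i"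
    \<comment> \<open>Going forward \<open>Suc i\<close> steps consumes \<open>Suc i\<close> factors
      2; the remaining \<open>2 ^ ?k\<close> is prime to 3 and joins the multiplier
      \<open>t\<close>.\<close>
    let ?x = "(2 ^ ?k / 3 ^ Suc m) *\<^sub>R real_pair ((inverse_fib ^^ Suc i) d)"
    show "(2 ^ J / 3 ^ Suc m) *\<^sub>R real_pair d = ((\<lambda>\<xi>. \<xi> v* real_mat fib_matrix) ^^ Suc i) ?x"
    proof -
      have "(2::real) ^ J = 2 ^ ?k * 2 ^ Suc i"
        using J by (simp only: power_add[symmetric] le_add_diff_inverse2)
      then show ?thesis unfolding fib_matrix_inverse_fib by simp
    qed
    have "(inverse_fib ^^ Suc i) d = (inverse_fib ^^ i) (inverse_fib d)"
      by (simp add: funpow_swap1)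
    then have "?x = of_int (2 ^ ?k * t) *\<^sub>R ((1 / 3 ^ Suc m) *\<^sub>R real_pair s) + real_pair (2 ^ ?k * w1, 2 ^ ?k * w2)"
      unfolding i by (simp add: vec_eq_iff forall_2 field_simps)
    moreover have "\<not> (3::int) dvd 2 ^ ?k * t"
      using t prime_3_int by (auto simp: prime_dvd_mult_iff dest: prime_dvd_power[OF prime_3_int])
    ultimately show "mask_zero ?x"
      using mask_zero_scale_add[OF zero] by metis
  qed
  then show ?thesis by blast
qed

text \<open>After division by \<open>3 ^ n\<close>, the difference of \<open>y\<close> and
  \<open>y'\<close> is \<open>d\<close> over \<open>3 ^ Suc m\<close> with \<open>d\<close> not
  divisible by 3, and \<open>s\<close> supplies a mask zero with the same denominator.\<close>

lemma contains_orthogonal: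
  fixes Y :: "(int \<times> int) set"
  assumes Y: "finite Y"
    and diff: "\<And>y y'. y \<in> Y \<Longrightarrow> y' \<in> Y \<Longrightarrow> y \<noteq> y' \<Longrightarrow>
      \<exists>m d s. fst y - fst y' = fst d * 3 ^ (n - Suc m) \<and> snd y - snd y' = snd d * 3 ^ (n - Suc m) \<and> Suc m \<le> n \<and>
        \<not> (3 dvd fst d \<and> 3 dvd snd d) \<and> \<not> (3 dvd fst s \<and> 3 dvd snd s) \<and>
        mask_zero ((1 / 3 ^ Suc m) *\<^sub>R real_pair s)"
  shows "contains_orthogonal_exponentials (self_affine_measure (real_mat fib_matrix) digits) (card Y)"
proof -
  let ?A = "\<lambda>\<xi>. \<xi> v* real_mat fib_matrix"
  have "\<exists>j. \<forall>J\<ge>j. \<exists>k x. mask_zero x \<and> (2 ^ J / 3 ^ n) *\<^sub>R (real_pair y - real_pair y') = (?A ^^ Suc k) x"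
    if yy: "y \<in> Y" "y' \<in> Y" "y \<noteq> y'" for y y'
  proof -
    obtain m d s where d: "fst y - fst y' = fst d * 3 ^ (n - Suc m)" "snd y - snd y' = snd d * 3 ^ (n - Suc m)"
      and m: "Suc m \<le> n" and ds: "\<not> (3 dvd fst d \<and> 3 dvd snd d)" "\<not> (3 dvd fst s \<and> 3 dvd snd s)"
      and zero: "mask_zero ((1 / 3 ^ Suc m) *\<^sub>R real_pair s)"
      using diff[OF yy] by blast
    have "real_pair y - real_pair y' = 3 ^ (n - Suc m) *\<^sub>R real_pair d"
      using arg_cong[OF d(1), of real_of_int] arg_cong[OF d(2), of real_of_int]
      by (simp add: vec_eq_iff forall_2)
    moreover have "(3::real) ^ n = 3 ^ (n - Suc m) * 3 ^ Suc m"
      using m by (simp only: power_add[symmetric] le_add_diff_inverse2)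
    ultimately have "(2 ^ J / 3 ^ n) *\<^sub>R (real_pair y - real_pair y') = (2 ^ J / 3 ^ Suc m) *\<^sub>R real_pair d" for J
      by simp
    then show ?thesis using orbit_meets_mask_zero[OF ds zero] by simp
  qed
  then obtain j where j: "\<And>y y' J. y \<in> Y \<Longrightarrow> y' \<in> Y \<Longrightarrow> y \<noteq> y' \<Longrightarrow> J \<ge> j y y' \<Longrightarrow>
    \<exists>k x. mask_zero x \<and> (2 ^ J / 3 ^ n) *\<^sub>R (real_pair y - real_pair y') = (?A ^^ Suc k) x"
    by metis
  \<comment> \<open>The sum of the finitely many thresholds exceeds or equals each of them, so one
    power of 2 serves all pairs.\<close>
  define J where "J = (\<Sum>(y, y')\<in>Y \<times> Y. j y y')"
  have J: "J \<ge> j y y'" if "y \<in> Y" "y' \<in> Y" for y y'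
    using member_le_sum[of "(y, y')" "Y \<times> Y" "\<lambda>(y, y'). j y y'"] that Y by (simp add: J_def)
  define \<Lambda> where "\<Lambda> = (\<lambda>y. (2 ^ J / 3 ^ n) *\<^sub>R real_pair y) ` Y"
  have "inj_on (\<lambda>y. (2 ^ J / 3 ^ n) *\<^sub>R real_pair y) Y"
    by (auto simp: inj_on_def vec_eq_iff forall_2 prod_eq_iff)
  then have "card \<Lambda> = card Y" by (simp add: \<Lambda>_def card_image)
  moreover have "orthogonal_exponentials (self_affine_measure (real_mat fib_matrix) digits) \<Lambda>"
    unfolding orthogonal_exponentials_def orthogonal_in_L2_fourier
  proof (intro ballI impI)
    fix \<xi> \<kappa> assume "\<xi> \<in> \<Lambda>" "\<kappa> \<in> \<Lambda>" "\<xi> \<noteq> \<kappa>"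
    then obtain y y' where y: "y \<in> Y" "y' \<in> Y" "y \<noteq> y'"
      and "\<xi> = (2 ^ J / 3 ^ n) *\<^sub>R real_pair y" "\<kappa> = (2 ^ J / 3 ^ n) *\<^sub>R real_pair y'"
      unfolding \<Lambda>_def by blast
    then have "\<xi> - \<kappa> = (2 ^ J / 3 ^ n) *\<^sub>R (real_pair y - real_pair y')"
      by (simp only: scaleR_diff_right)
    then have "\<exists>k x. mask_zero x \<and> \<xi> - \<kappa> = (?A ^^ Suc k) x"
      using j[OF y J[OF y(1,2)]] by simp
    moreover have "expanding (real_mat fib_matrix)" "det fib_matrix \<noteq> 0"
      using expanding_fib_matrix by (simp_all add: fib_matrix_def det_2)
    ultimately show "fourier (self_affine_measure (real_mat fib_matrix) digits) (\<xi> - \<kappa>) = 0"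
      by (subst fourier_eq_0) auto
  qed
  ultimately show ?thesis
    using Y by (auto simp: contains_orthogonal_exponentials_def \<Lambda>_def)
qed

text \<open>Cramer's rule for inner products \<open>p / 3\<close> and \<open>m - p / 3\<close> with
  the two nonzero digits.\<close>

lemma mask_zero_coordinates:
  assumes "mask_zero x"
  obtains p m :: int where "\<not> 3 dvd p"
    "3 * of_int (a1 * b2 - a2 * b1) * x$1 = of_int ((a2 + b2) * p - 3 * a2 * m)"
    "3 * of_int (a1 * b2 - a2 * b1) * x$2 = of_int (3 * a1 * m - (a1 + b1) * p)"
proof -
  obtain p m :: int where
    p: "3 * (x$1 * of_int a1 + x$2 * of_int a2) = of_int p" and
    m: "x$1 * of_int a1 + x$2 * of_int a2 + (x$1 * of_int b1 + x$2 * of_int b2) = of_int m"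
    and np: "\<not> (3::int) dvd p"
    using assms by (auto simp: mask_zero_def)
  show thesis
    by (rule that[OF np, of m]) (simp_all add: algebra_simps flip: p m)
qed

lemma nondivisible_mask_zero:
  assumes "\<not> (3 dvd a1 + b1 \<and> 3 dvd a2 + b2)" and "mask_zero x"
  shows "nondivisible 3 (3 * of_int (a1 * b2 - a2 * b1)) x"
proof -
  obtain p m :: int where p: "\<not> 3 dvd p"
    and x: "3 * of_int (a1 * b2 - a2 * b1) * x$1 = of_int ((a2 + b2) * p - 3 * a2 * m)"
    "3 * of_int (a1 * b2 - a2 * b1) * x$2 = of_int (3 * a1 * m - (a1 + b1) * p)"
    using mask_zero_coordinates[OF assms(2)] .
  have "3 dvd (a2 + b2) * p - 3 * a2 * m \<longleftrightarrow> 3 dvd (a2 + b2) * p"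
    "3 dvd 3 * a1 * m - (a1 + b1) * p \<longleftrightarrow> 3 dvd (a1 + b1) * p"
    by (simp_all only: mult.assoc dvd_diff_left_iff dvd_diff_right_iff dvd_triv_left)
  then have "\<not> (3 dvd (a2 + b2) * p - 3 * a2 * m \<and> 3 dvd 3 * a1 * m - (a1 + b1) * p)"
    using assms(1) p prime_3_int by (auto simp: prime_dvd_mult_iff)
  with x show ?thesis unfolding nondivisible_def by blast
qed

lemma nondivisible_mask_zero_power:
  assumes ab: "3 dvd a1 + b1" "3 dvd a2 + b2" and \<eta>: "\<not> 3 ^ Suc \<eta> dvd a1 * b2 - a2 * b1" and x: "mask_zero x"
  shows "nondivisible (3 ^ \<eta>) (of_int (a1 * b2 - a2 * b1)) x"
proof -
  obtain k1 k2 where "a1 + b1 = 3 * k1" "a2 + b2 = 3 * k2" using ab by (auto elim!: dvdE)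
  then have k: "b1 = 3 * k1 - a1" "b2 = 3 * k2 - a2" by auto
  obtain p m :: int where p: "\<not> 3 dvd p"
    and x: "3 * of_int (a1 * b2 - a2 * b1) * x$1 = of_int ((a2 + b2) * p - 3 * a2 * m)"
    "3 * of_int (a1 * b2 - a2 * b1) * x$2 = of_int (3 * a1 * m - (a1 + b1) * p)"
    using mask_zero_coordinates[OF x] .
  have "of_int (a1 * b2 - a2 * b1) * x$1 = of_int (k2 * p - a2 * m)"
    "of_int (a1 * b2 - a2 * b1) * x$2 = of_int (a1 * m - k1 * p)"
    using x by (simp_all add: k algebra_simps)
  moreover have "\<not> (3 ^ \<eta> dvd k2 * p - a2 * m \<and> 3 ^ \<eta> dvd a1 * m - k1 * p)"
  proof
    assume "3 ^ \<eta> dvd k2 * p - a2 * m \<and> 3 ^ \<eta> dvd a1 * m - k1 * p"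
    \<comment> \<open>This combination eliminates \<open>m\<close> and leaves \<open>p\<close> times
      a third of the determinant, which would give the determinant one factor 3 too many.\<close>
    then have "3 ^ \<eta> dvd a1 * (k2 * p - a2 * m) + a2 * (a1 * m - k1 * p)"
      by (intro dvd_add dvd_mult) auto
    also have "a1 * (k2 * p - a2 * m) + a2 * (a1 * m - k1 * p) = p * (a1 * k2 - a2 * k1)"
      by algebra
    finally have "3 ^ \<eta> dvd p * (a1 * k2 - a2 * k1)" .
    moreover have "coprime (3 ^ \<eta>) p"
      using p prime_3_int by (simp add: prime_imp_coprime)
    ultimately have "3 ^ \<eta> dvd a1 * k2 - a2 * k1"
      by (simp add: coprime_dvd_mult_right_iff)
    then have "3 * 3 ^ \<eta> dvd 3 * (a1 * k2 - a2 * k1)" by (rule mult_dvd_mono[OF dvd_refl])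
    also have "3 * (a1 * k2 - a2 * k1) = a1 * b2 - a2 * b1" by (simp add: k algebra_simps)
    finally show False using \<eta> by simp
  qed
  ultimately show ?thesis unfolding nondivisible_def by blast
qed

text \<open>The chosen vector is orthogonal to the sum of the two digits, so the integer
  \<open>m\<close> is 0, and its inner product with the first digit is the determinant.\<close>

lemma mask_zero_witness:
  assumes \<eta>: "3 ^ \<eta> dvd a1 * b2 - a2 * b1" "\<not> 3 ^ Suc \<eta> dvd a1 * b2 - a2 * b1"
  shows "mask_zero ((1 / 3 ^ Suc \<eta>) *\<^sub>R real_pair (a2 + b2, - (a1 + b1)))"
proof -
  obtain \<gamma> where \<gamma>: "a1 * b2 - a2 * b1 = 3 ^ \<eta> * \<gamma>" using \<eta>(1) by (auto elim: dvdE)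
  then have "\<not> 3 dvd \<gamma>" using \<eta>(2) by auto
  moreover have "(of_int a1 * of_int b2 - of_int a2 * of_int b1 :: real) = 3 ^ \<eta> * of_int \<gamma>"
    using arg_cong[OF \<gamma>, of real_of_int] by simp
  ultimately show ?thesis
    unfolding mask_zero_def by (intro exI[of _ \<gamma>] exI[of _ 0]) (simp add: field_simps)
qed

text \<open>\<open>(- a2, a1)\<close> is orthogonal to the first digit. Adding \<open>3 ^ m\<close>
  to one coordinate makes that inner product, after scaling, a third of \<open>a1\<close> or
  \<open>a2\<close>; the coordinate is chosen so that this is not an integer.\<close>

lemma mask_zero_witness_power:
  assumes ab: "3 dvd a1 + b1" "3 dvd a2 + b2" and a: "\<not> (3 dvd a1 \<and> 3 dvd a2)"
    and m: "3 ^ Suc m dvd a1 * b2 - a2 * b1"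
  shows "\<exists>s. \<not> (3 dvd fst s \<and> 3 dvd snd s) \<and> mask_zero ((1 / 3 ^ Suc m) *\<^sub>R real_pair s)"
proof -
  obtain k1 k2 where k: "a1 + b1 = 3 * k1" "a2 + b2 = 3 * k2" using ab by (auto elim!: dvdE)
  obtain \<delta> where \<delta>: "a1 * b2 - a2 * b1 = 3 ^ Suc m * \<delta>" using m by (auto elim: dvdE)
  have r: "real_of_int b1 = 3 * of_int k1 - of_int a1" "real_of_int b2 = 3 * of_int k2 - of_int a2"
    using arg_cong[OF k(1), of real_of_int] arg_cong[OF k(2), of real_of_int] by simp_all
  have \<delta>r: "3 * (real_of_int a1 * of_int k2 - of_int a2 * of_int k1) = 3 * 3 ^ m * of_int \<delta>"
    using arg_cong[OF \<delta>, of real_of_int] by (simp add: r algebra_simps)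
  show ?thesis
  proof (cases "3 dvd a1")
    case False
    have "mask_zero ((1 / 3 ^ Suc m) *\<^sub>R real_pair (3 ^ m - a2, a1))"
      unfolding mask_zero_def
      by (intro exI[of _ a1] exI[of _ "k1 + \<delta>"])
        (use False \<delta>r in \<open>simp add: r field_simps\<close>)
    then show ?thesis using False by (intro exI[of _ "(3 ^ m - a2, a1)"]) simp
  next
    case True
    then have a2: "\<not> 3 dvd a2" using a by simp
    have "mask_zero ((1 / 3 ^ Suc m) *\<^sub>R real_pair (- a2, a1 + 3 ^ m))"
      unfolding mask_zero_def
      by (intro exI[of _ a2] exI[of _ "k2 + \<delta>"])
        (use a2 \<delta>r in \<open>simp add: r field_simps\<close>)
    then show ?thesis using a2 by (intro exI[of _ "(- a2, a1 + 3 ^ m)"]) simp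
  qed
qed

end

section \<open>The two cases of the theorem\<close>

lemma common_power_of_3:
  fixes x y :: int
  assumes "\<not> (3 ^ \<eta> dvd x \<and> 3 ^ \<eta> dvd y)"
  shows "\<exists>r d. r < \<eta> \<and> x = fst d * 3 ^ r \<and> y = snd d * 3 ^ r \<and> \<not> (3 dvd fst d \<and> 3 dvd snd d)"
  using assms
proof (induction \<eta>)
  case (Suc \<eta>)
  show ?case
  proof (cases "3 ^ \<eta> dvd x \<and> 3 ^ \<eta> dvd y")
    case True
    then obtain u v where uv: "x = u * 3 ^ \<eta>" "y = v * 3 ^ \<eta>" by (auto simp: dvd_def mult.commute)
    then have "\<not> (3 dvd u \<and> 3 dvd v)" using Suc.prems by auto
    then show ?thesis using uv by (intro exI[of _ \<eta>] exI[of _ "(u, v)"]) simp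
  next
    case False
    then show ?thesis using Suc.IH less_SucI by blast
  qed
qed simp

theorem theorem1p1:
  fixes \<alpha>\<^sub>1 \<alpha>\<^sub>2 \<beta>\<^sub>1 \<beta>\<^sub>2 :: int
    and D :: "(real^2) set"
    and \<eta> :: nat
  assumes D: "D = {vector [0, 0],
                   vector [of_int \<alpha>\<^sub>1, of_int \<alpha>\<^sub>2],
                   vector [of_int \<beta>\<^sub>1, of_int \<beta>\<^sub>2]}"
    and det_nz: "\<alpha>\<^sub>1 * \<beta>\<^sub>2 - \<alpha>\<^sub>2 * \<beta>\<^sub>1 \<noteq> 0"
    and gcd1: "Gcd {\<alpha>\<^sub>1, \<alpha>\<^sub>2, \<beta>\<^sub>1, \<beta>\<^sub>2} = 1"
    and \<eta>: "\<eta> = Max {r::nat. 3 ^ r dvd (\<alpha>\<^sub>1 * \<beta>\<^sub>2 - \<alpha>\<^sub>2 * \<beta>\<^sub>1)}"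
  shows "(\<not> 3 dvd (2 * \<alpha>\<^sub>1 - \<beta>\<^sub>1) \<or> \<not> 3 dvd (2 * \<alpha>\<^sub>2 - \<beta>\<^sub>2) \<longrightarrow>
           (\<forall>M::int^2^2. expanding (real_mat M) \<and> \<not> 3 dvd det M \<longrightarrow>
              at_most_orthogonal_exponentials (self_affine_measure (real_mat M) D) 9) \<and>
           (\<exists>M::int^2^2. expanding (real_mat M) \<and> \<not> 3 dvd det M \<and>
              contains_orthogonal_exponentials (self_affine_measure (real_mat M) D) 9))
       \<and> (3 dvd (2 * \<alpha>\<^sub>1 - \<beta>\<^sub>1) \<and> 3 dvd (2 * \<alpha>\<^sub>2 - \<beta>\<^sub>2) \<longrightarrow>
           (\<forall>M::int^2^2. expanding (real_mat M) \<and> \<not> 3 dvd det M \<longrightarrow>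
              at_most_orthogonal_exponentials (self_affine_measure (real_mat M) D) (3 ^ (2 * \<eta>))) \<and>
           (\<exists>M::int^2^2. expanding (real_mat M) \<and> \<not> 3 dvd det M \<and>
              contains_orthogonal_exponentials (self_affine_measure (real_mat M) D) (3 ^ (2 * \<eta>))))"
proof -
  let ?\<Delta> = "\<alpha>\<^sub>1 * \<beta>\<^sub>2 - \<alpha>\<^sub>2 * \<beta>\<^sub>1"
  interpret three_digits \<alpha>\<^sub>1 \<alpha>\<^sub>2 \<beta>\<^sub>1 \<beta>\<^sub>2
    by unfold_locales (rule det_nz)
  have D_digits: "D = digits" by (simp add: D digits_def)
  \<comment> \<open>A nonzero determinant makes this set finite, so \<open>Max\<close> is the 3-adic
    valuation.\<close>
  have "{r. 3 ^ r dvd ?\<Delta>} = {..multiplicity 3 ?\<Delta>}"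
    using det_nz by (auto simp: power_dvd_iff_le_multiplicity)
  then have "\<eta> = Max {..multiplicity 3 ?\<Delta>}" by (simp only: \<eta>)
  also have "\<dots> = multiplicity 3 ?\<Delta>" by (rule Max_eqI) auto
  finally have "\<eta> = multiplicity 3 ?\<Delta>" .
  then have \<eta>_dvd: "3 ^ \<eta> dvd ?\<Delta>" and \<eta>_not_dvd: "\<not> 3 ^ Suc \<eta> dvd ?\<Delta>"
    using det_nz by (simp_all add: power_dvd_iff_le_multiplicity del: power_Suc)
  \<comment> \<open>As 2 is -1 modulo 3, the case distinction concerns the sum of the two
    digits.\<close>
  have dvd_iff: "3 dvd 2 * \<alpha>\<^sub>1 - \<beta>\<^sub>1 \<longleftrightarrow> 3 dvd \<alpha>\<^sub>1 + \<beta>\<^sub>1" "3 dvd 2 * \<alpha>\<^sub>2 - \<beta>\<^sub>2 \<longleftrightarrow> 3 dvd \<alpha>\<^sub>2 + \<beta>\<^sub>2"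
    by presburger+
  have fib: "expanding (real_mat fib_matrix)" "\<not> 3 dvd det fib_matrix"
    using expanding_fib_matrix by (simp_all add: fib_matrix_def det_2)
  have residue_eq: "u = v" if "N dvd u - v" "u \<in> {0..<N}" "v \<in> {0..<N}" for u v N :: int
    using that by (metis atLeastLessThan_iff mod_eq_dvd_iff mod_pos_pos_trivial)
  show ?thesis
    unfolding D_digits dvd_iff
  proof (intro conjI impI allI; (elim conjE)?)
    assume ab: "\<not> 3 dvd \<alpha>\<^sub>1 + \<beta>\<^sub>1 \<or> \<not> 3 dvd \<alpha>\<^sub>2 + \<beta>\<^sub>2"
    fix M :: "int^2^2" assume M: "expanding (real_mat M)" "\<not> 3 dvd det M"
    have "at_most_orthogonal_exponentials (self_affine_measure (real_mat M) digits) (nat 3 ^ 2)"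
    proof (rule at_most_orthogonal)
      show "coprime 3 (det M)" using M prime_3_int by (simp add: prime_imp_coprime)
      show "nondivisible 3 (3 * of_int ?\<Delta>) s" if "mask_zero s" for s
        using nondivisible_mask_zero[OF _ that] ab by simp
    qed (use M in auto)
    then show "at_most_orthogonal_exponentials (self_affine_measure (real_mat M) digits) 9" by simp
  next
    assume ab: "\<not> 3 dvd \<alpha>\<^sub>1 + \<beta>\<^sub>1 \<or> \<not> 3 dvd \<alpha>\<^sub>2 + \<beta>\<^sub>2"
    \<comment> \<open>All residue pairs modulo 3: no difference of distinct ones is divisible by 3,
      so the single denominator \<open>3 ^ Suc \<eta>\<close> and the single witness
      \<open>?s\<close> serve every pair.\<close>
    let ?Y = "{0..<3 :: int} \<times> {0..<3 :: int}" and ?s = "(\<alpha>\<^sub>2 + \<beta>\<^sub>2, - (\<alpha>\<^sub>1 + \<beta>\<^sub>1))"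
    have "contains_orthogonal_exponentials (self_affine_measure (real_mat fib_matrix) digits) (card ?Y)"
    proof (rule contains_orthogonal[where n = "Suc \<eta>"])
      fix y y' assume *: "y \<in> ?Y" "y' \<in> ?Y" "y \<noteq> y'"
      let ?d = "(fst y - fst y', snd y - snd y')"
      have "\<not> (3 dvd fst ?d \<and> 3 dvd snd ?d)"
        using * residue_eq[of 3 "fst y" "fst y'"] residue_eq[of 3 "snd y" "snd y'"]
        unfolding mem_Times_iff prod_eq_iff fst_conv snd_conv by blast
      moreover have "\<not> (3 dvd fst ?s \<and> 3 dvd snd ?s)"
        using ab unfolding fst_conv snd_conv dvd_minus_iff by blast
      ultimately show "\<exists>m d s. fst y - fst y' = fst d * 3 ^ (Suc \<eta> - Suc m) \<and>
          snd y - snd y' = snd d * 3 ^ (Suc \<eta> - Suc m) \<and> Suc m \<le> Suc \<eta> \<and>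
          \<not> (3 dvd fst d \<and> 3 dvd snd d) \<and> \<not> (3 dvd fst s \<and> 3 dvd snd s) \<and>
          mask_zero ((1 / 3 ^ Suc m) *\<^sub>R real_pair s)"
        using mask_zero_witness[OF \<eta>_dvd \<eta>_not_dvd]
        by (intro exI[of _ \<eta>] exI[of _ ?d] exI[of _ ?s]) auto
    qed simp
    then show "\<exists>M. expanding (real_mat M) \<and> \<not> 3 dvd det M \<and>
        contains_orthogonal_exponentials (self_affine_measure (real_mat M) digits) 9"
      using fib by (intro exI[of _ fib_matrix]) (simp add: card_cartesian_product)
  next
    assume ab: "3 dvd \<alpha>\<^sub>1 + \<beta>\<^sub>1" "3 dvd \<alpha>\<^sub>2 + \<beta>\<^sub>2"
    fix M :: "int^2^2" assume M: "expanding (real_mat M)" "\<not> 3 dvd det M"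
    have "at_most_orthogonal_exponentials (self_affine_measure (real_mat M) digits) (nat (3 ^ \<eta>) ^ 2)"
    proof (rule at_most_orthogonal)
      show "coprime (3 ^ \<eta>) (det M)" using M prime_3_int by (simp add: prime_imp_coprime)
      show "nondivisible (3 ^ \<eta>) (of_int ?\<Delta>) s" if "mask_zero s" for s
        by (rule nondivisible_mask_zero_power[OF ab \<eta>_not_dvd that])
    qed (use M in auto)
    then show "at_most_orthogonal_exponentials (self_affine_measure (real_mat M) digits) (3 ^ (2 * \<eta>))"
      by (simp add: nat_power_eq power_mult mult.commute[of 2])
  next
    assume ab: "3 dvd \<alpha>\<^sub>1 + \<beta>\<^sub>1" "3 dvd \<alpha>\<^sub>2 + \<beta>\<^sub>2"
    \<comment> \<open>Here the gcd condition enters: each \<beta> is minus its \<alpha> modulo 3, so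
      3 would divide all four coordinates.\<close>
    have a: "\<not> (3 dvd \<alpha>\<^sub>1 \<and> 3 dvd \<alpha>\<^sub>2)"
    proof
      assume "3 dvd \<alpha>\<^sub>1 \<and> 3 dvd \<alpha>\<^sub>2"
      moreover from this ab have "3 dvd \<beta>\<^sub>1" "3 dvd \<beta>\<^sub>2" by presburger+
      ultimately have "3 dvd Gcd {\<alpha>\<^sub>1, \<alpha>\<^sub>2, \<beta>\<^sub>1, \<beta>\<^sub>2}" by (intro Gcd_greatest) auto
      then show False unfolding gcd1 by simp
    qed
    let ?Y = "{0..<3 ^ \<eta> :: int} \<times> {0..<3 ^ \<eta> :: int}"
    have "contains_orthogonal_exponentials (self_affine_measure (real_mat fib_matrix) digits) (card ?Y)"
    proof (rule contains_orthogonal[where n = \<eta>])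
      fix y y' assume *: "y \<in> ?Y" "y' \<in> ?Y" "y \<noteq> y'"
      have "\<not> (3 ^ \<eta> dvd fst y - fst y' \<and> 3 ^ \<eta> dvd snd y - snd y')"
        using * residue_eq[of "3 ^ \<eta>" "fst y" "fst y'"] residue_eq[of "3 ^ \<eta>" "snd y" "snd y'"]
        unfolding mem_Times_iff prod_eq_iff by blast
      from common_power_of_3[OF this] obtain r d where r: "r < \<eta>"
        and d: "fst y - fst y' = fst d * 3 ^ r" "snd y - snd y' = snd d * 3 ^ r" "\<not> (3 dvd fst d \<and> 3 dvd snd d)"
        by blast
      \<comment> \<open>Exactly \<open>3 ^ r\<close> cancels from the difference, leaving the
        denominator \<open>3 ^ Suc m\<close>; it divides the determinant, as the witness
        requires.\<close>
      obtain m where m: "\<eta> = r + Suc m" using r by (auto simp: less_iff_Suc_add)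
      have "3 ^ Suc m dvd ?\<Delta>"
        by (rule dvd_trans[OF le_imp_power_dvd \<eta>_dvd]) (simp add: m)
      from mask_zero_witness_power[OF ab a this] obtain s where
        "\<not> (3 dvd fst s \<and> 3 dvd snd s)" "mask_zero ((1 / 3 ^ Suc m) *\<^sub>R real_pair s)"
        by blast
      with d show "\<exists>m d s. fst y - fst y' = fst d * 3 ^ (\<eta> - Suc m) \<and>
          snd y - snd y' = snd d * 3 ^ (\<eta> - Suc m) \<and> Suc m \<le> \<eta> \<and>
          \<not> (3 dvd fst d \<and> 3 dvd snd d) \<and> \<not> (3 dvd fst s \<and> 3 dvd snd s) \<and>
          mask_zero ((1 / 3 ^ Suc m) *\<^sub>R real_pair s)"
        by (intro exI[of _ m] exI[of _ d] exI[of _ s]) (simp add: m)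
    qed simp
    then show "\<exists>M. expanding (real_mat M) \<and> \<not> 3 dvd det M \<and>
        contains_orthogonal_exponentials (self_affine_measure (real_mat M) digits) (3 ^ (2 * \<eta>))"
      using fib by (intro exI[of _ fib_matrix])
        (simp add: card_cartesian_product nat_power_eq mult_2 power_add)
  qed
qed

end
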